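(* Let $X$ be a real Lévy process which is not a compound Poisson process and such that $|X|$ is not a subordinator. Assume that for every $t>0$ the law of $X_t$ under $\mathbb{P}$ is absolutely continuous on $[0,\infty)$, with density $p_t(x)$, and that the Lévy measure of $X$ is absolutely continuous on $(0,\infty)$, with density $\nu(x)$. Let $f_t(x)$ be the density on $(0,\infty)$ of the law of $\overline X_t=\sup_{s\le t}X_s$ under $\mathbb{P}$. Assume that $\nu$ is uniformly continuous on $(x_1,\infty)$ for some $x_1>0$. If there exists $x_0>0$ such that $$\lim_{t\to0^+}\frac{p_t(x)}{t}=\nu(x)\quad\text{uniformly for } x\ge x_0,$$ then there exists $x_2>0$ such that $$\lim_{t\to0^+}\frac{f_t(x)}{t}=\nu(x)\quad\text{uniformly for } x\ge x_2.$$
   Context: Under $\mathbb{P}$ the process $X$ is a càdlàg real Lévy process started at $0$. It is known that, under the stated absolute continuity of the laws of $X_t$ on $[0,\infty)$, the law of $\overline X_t$ is absolutely continuous on $(0,\infty)$ (it may have an atom at $0$). Convention: $p_t$ and $f_t$ are defined up to Lebesgue-null sets of $x$; statements about them are understood for Lebesgue-almost every $x$ in the indicated range (uniform convergence being in the essential supremum sense). *)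

theory Defs
  imports "HOL-Probability.Probability"
begin

definition cadlag :: "(real \<Rightarrow> real) \<Rightarrow> bool" where
  "cadlag x \<longleftrightarrow>
     (\<forall>t\<ge>0. (x \<longlongrightarrow> x t) (at_right t)) \<and> (\<forall>t>0. \<exists>l. (x \<longlongrightarrow> l) (at_left t))"

text \<open>
  Only the times \<open>t \<ge> 0\<close> matter. As on the canonical space, every path is cadlag, so that
  running suprema are random variables; the starting point is prescribed almost surely.
\<close>

locale levy_process = prob_space M for M :: "'a measure" +
  fixes X :: "real \<Rightarrow> 'a \<Rightarrow> real"
  assumes measurable_X: "\<And>t. 0 \<le> t \<Longrightarrow> X t \<in> borel_measurable M"
    and start: "AE \<omega> in M. X 0 \<omega> = 0"
    and cadlag_paths: "\<And>\<omega>. \<omega> \<in> space M \<Longrightarrow> cadlag (\<lambda>t. X t \<omega>)"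
    and indep_increments:
      "\<And>(n::nat) \<tau>. 0 \<le> \<tau> 0 \<Longrightarrow> (\<And>i. i < n \<Longrightarrow> \<tau> i \<le> \<tau> (Suc i)) \<Longrightarrow>
        indep_vars (\<lambda>_. borel) (\<lambda>i \<omega>. X (\<tau> (Suc i)) \<omega> - X (\<tau> i) \<omega>) {..<n}"
    and stationary_increments:
      "\<And>s t. 0 \<le> s \<Longrightarrow> 0 \<le> t \<Longrightarrow>
        distr M borel (\<lambda>\<omega>. X (s + t) \<omega> - X s \<omega>) = distr M borel (X t)"

definition subordinator :: "'a measure \<Rightarrow> (real \<Rightarrow> 'a \<Rightarrow> real) \<Rightarrow> bool" where
  "subordinator M X \<longleftrightarrow> levy_process M X \<and> (AE \<omega> in M. mono_on {0..} (\<lambda>t. X t \<omega>))"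

text \<open>
  Jump rate \<open>c\<close> and jump law \<open>F\<close>; as usual this is expressed through the marginal laws,
  which determine the law of a Levy process.
\<close>

definition compound_poisson_process :: "'a measure \<Rightarrow> (real \<Rightarrow> 'a \<Rightarrow> real) \<Rightarrow> bool" where
  "compound_poisson_process M X \<longleftrightarrow> levy_process M X \<and>
     (\<exists>c F. 0 < c \<and> prob_space F \<and> sets F = sets borel \<and> measure F {0} = 0 \<and>
        (\<forall>t\<ge>0. \<forall>u. char (distr M borel (X t)) u
           = exp (of_real (t * c) * (char F u - 1))))"

text \<open>
  \<open>\<Lambda>\<close> is the jump measure in the Levy--Khintchine representation of \<open>X\<close>, with drift \<open>a\<close> and
  Gaussian coefficient \<open>\<sigma>\<close>. The choice of the truncation function only affects \<open>a\<close>.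
\<close>

definition is_levy_measure ::
    "'a measure \<Rightarrow> (real \<Rightarrow> 'a \<Rightarrow> real) \<Rightarrow> real measure \<Rightarrow> bool" where
  "is_levy_measure M X \<Lambda> \<longleftrightarrow>
     sets \<Lambda> = sets borel \<and> emeasure \<Lambda> {0} = 0 \<and>
     (\<integral>\<^sup>+ x. ennreal (min 1 (x\<^sup>2)) \<partial>\<Lambda>) < \<infinity> \<and>
     (\<exists>a \<sigma>. \<forall>t\<ge>0. \<forall>u. char (distr M borel (X t)) u
        = exp (of_real t *
            (\<i> * of_real (a * u) - of_real (\<sigma>\<^sup>2 * u\<^sup>2 / 2) +
             (CLINT x|\<Lambda>. iexp (u * x) - 1 - \<i> * of_real (u * x * indicator {-1<..<1} x)))))"

definition running_sup :: "(real \<Rightarrow> 'a \<Rightarrow> real) \<Rightarrow> real \<Rightarrow> 'a \<Rightarrow> real" where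
  "running_sup X t \<omega> = (SUP s\<in>{0..t}. X s \<omega>)"

text \<open>
  The restriction of \<open>\<mu>\<close> to \<open>S\<close> is absolutely continuous with density \<open>g\<close>; nothing is
  required of \<open>\<mu>\<close> or \<open>g\<close> outside \<open>S\<close>.
\<close>

definition has_density_on :: "real measure \<Rightarrow> real set \<Rightarrow> (real \<Rightarrow> real) \<Rightarrow> bool" where
  "has_density_on \<mu> S g \<longleftrightarrow>
     set_borel_measurable lborel S g \<and> (AE x in lborel. x \<in> S \<longrightarrow> 0 \<le> g x) \<and>
     (\<forall>B\<in>sets borel. B \<subseteq> S \<longrightarrow> emeasure \<mu> B = (\<integral>\<^sup>+ x\<in>B. ennreal (g x) \<partial>lborel))"

text \<open>Analogue of \<^const>\<open>uniform_limit\<close> for the essential supremum with respect to Lebesgue measure.\<close>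

definition ess_uniform_limit ::
    "real set \<Rightarrow> ('b \<Rightarrow> real \<Rightarrow> real) \<Rightarrow> (real \<Rightarrow> real) \<Rightarrow> 'b filter \<Rightarrow> bool" where
  "ess_uniform_limit S g h F \<longleftrightarrow>
     (\<forall>\<epsilon>>0. \<forall>\<^sub>F t in F. AE x in lborel. x \<in> S \<longrightarrow> dist (g t x) (h x) < \<epsilon>)"

end

theory Submission
  imports Defs
begin

text \<open>
  Sample \<open>X\<close> on a grid of mesh \<open>t/n\<close>, giving a random walk with maximum \<open>S\<close>, and let \<open>k\<close> be its first
  argmax. For \<open>S\<close> large and \<open>B\<close> a Borel set far from \<open>0\<close>, look backwards from \<open>k\<close> to the last index
  \<open>j\<close> at which the walk is at least \<open>2a\<close> below \<open>S\<close>. Either step \<open>j\<close> exceeds \<open>a\<close>: then \<open>S\<close> is this step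
  plus an independent quantity that is close to \<open>0\<close> with high probability, and summing
  \<open>P(\<xi>\<^sub>j \<in> B - g)\<close> over the \<open>n\<close> steps gives the main term \<open>t \<integral>\<^sub>B \<nu>\<close>. Or the walk is already above \<open>a\<close> at
  time \<open>j\<close>: then, conditionally on the later steps, \<open>S \<in> B\<close> costs \<open>O(t |B|)\<close> by the bound on the
  density of the walk at time \<open>j\<close>, while the events constraining the later steps have total probability
  \<open>o(1)\<close>. The matching lower bound comes from the disjoint events that the \<open>j\<close>-th step is the only large
  one. All bounds are uniform in \<open>n\<close> and survive \<open>n \<rightarrow> \<infinity>\<close> for open (upper) and compact (lower) sets
  \<open>B\<close>, from which regularity of Lebesgue measure yields the bounds on the density.
\<close>

subsection \<open>Independent splittings\<close>

text \<open>The obstacle is uniformity in \<open>n\<close>. The second case splits over about n^2/2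
  pairs (j, k), so bounding each pair separately is hopeless: the ascent probabilities themselves
  must sum to O(\<theta>), where \<theta> bounds the probability that the walk leaves
  [-\<eta>, \<eta>]. Hence the backward decomposition. It places every constraint on the steps from
  \<open>j\<close> on; the walk at \<open>j\<close> is independent of them and keeps its full
  density bound, so the two factors multiply. A forward first-passage split would constrain the very
  steps that supply the density.

  The first case has \<open>n\<close> terms, each of order t/n. There the shift \<open>g\<close>
  produced by the other steps is usually within 3\<eta>, where uniform continuity of \<nu> gives the
  sharp value; for other shifts only the supremum of \<nu> is available, and that cost is weighted
  by \<theta>. Both cases therefore need \<nu> bounded far out, which is derived from uniform
  continuity and the comparison with a probability law.\<close>

definition zero_outside :: "'i set \<Rightarrow> ('i \<Rightarrow> 'a \<Rightarrow> real) \<Rightarrow> 'a \<Rightarrow> 'i \<Rightarrow> real" where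
  "zero_outside A \<xi> \<omega> = (\<lambda>i. if i \<in> A then \<xi> i \<omega> else 0)"

context prob_space
begin

lemma emeasure_indep_var_slices:
  assumes ind: "indep_var N U L V" and S: "S \<in> sets (N \<Otimes>\<^sub>M L)"
  shows "emeasure M {\<omega>\<in>space M. (U \<omega>, V \<omega>) \<in> S} =
    (\<integral>\<^sup>+ \<omega>. emeasure M {\<omega>'\<in>space M. (U \<omega>, V \<omega>') \<in> S} \<partial>M)"
proof -
  have U[measurable]: "U \<in> measurable M N" and V[measurable]: "V \<in> measurable M L"
    and eq: "distr M N U \<Otimes>\<^sub>M distr M L V = distr M (N \<Otimes>\<^sub>M L) (\<lambda>x. (U x, V x))"
    using ind by (auto simp: indep_var_distribution_eq)
  note S[measurable]
  interpret V: prob_space "distr M L V" by (rule prob_space_distr) simp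
  have "emeasure M {\<omega>\<in>space M. (U \<omega>, V \<omega>) \<in> S} = emeasure (distr M (N \<Otimes>\<^sub>M L) (\<lambda>x. (U x, V x))) S"
    by (subst emeasure_distr) (auto intro!: arg_cong[where f="emeasure M"])
  also have "\<dots> = (\<integral>\<^sup>+ u. emeasure (distr M L V) (Pair u -` S) \<partial>distr M N U)"
    unfolding eq[symmetric] using S
    by (intro V.emeasure_pair_measure_alt)
       (simp cong: sets_pair_measure_cong)
  also have "\<dots> = (\<integral>\<^sup>+ \<omega>. emeasure (distr M L V) (Pair (U \<omega>) -` S) \<partial>M)"
    using V.measurable_emeasure_Pair[of S N] S
    by (intro nn_integral_distr) (simp_all cong: sets_pair_measure_cong measurable_cong_sets)
  also have "\<dots> = (\<integral>\<^sup>+ \<omega>. emeasure M {\<omega>'\<in>space M. (U \<omega>, V \<omega>') \<in> S} \<partial>M)"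
    by (intro nn_integral_cong, subst emeasure_distr)
       (auto intro!: arg_cong[where f="emeasure M"] sets_Pair1)
  finally show ?thesis .
qed

text \<open>Freeze \<open>U\<close> and bound each slice: the extra cost \<open>c\<close> is
  incurred only where \<open>Q\<close> holds, hence is paid with the probability of
  \<open>Q\<close>. It serves two ends: \<open>Q\<close> as a rare exceptional event next to a main
  term \<open>\<beta>\<close>, and, with \<open>\<beta> = 0\<close>, \<open>Q\<close> as the ascent
  event, which yields a product bound.\<close>

lemma prob_indep_var_le:
  assumes ind: "indep_var N U L V"
    and R: "Measurable.pred (N \<Otimes>\<^sub>M L) (\<lambda>(u, v). R u v)" and Q: "Measurable.pred N Q"
    and slices: "\<And>u. u \<in> space N \<Longrightarrow> prob {\<omega>\<in>space M. R u (V \<omega>)} \<le> \<beta> + (if Q u then c else 0)"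
    and nonneg: "0 \<le> \<beta>" "0 \<le> c"
  shows "prob {\<omega>\<in>space M. R (U \<omega>) (V \<omega>)} \<le> \<beta> + c * prob {\<omega>\<in>space M. Q (U \<omega>)}"
proof -
  have U[measurable]: "U \<in> measurable M N" and V[measurable]: "V \<in> measurable M L"
    using ind by (auto simp: indep_var_distribution_eq)
  note R[measurable] Q[measurable]
  let ?S = "{p \<in> space (N \<Otimes>\<^sub>M L). case p of (u, v) \<Rightarrow> R u v}"
  have UN: "\<omega> \<in> space M \<Longrightarrow> U \<omega> \<in> space N" and VN: "\<omega> \<in> space M \<Longrightarrow> V \<omega> \<in> space L" for \<omega>
    using measurable_space[OF U] measurable_space[OF V] by auto
  have "emeasure M {\<omega>\<in>space M. R (U \<omega>) (V \<omega>)} = emeasure M {\<omega>\<in>space M. (U \<omega>, V \<omega>) \<in> ?S}"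
    using UN VN by (intro arg_cong[where f="emeasure M"]) (auto simp: space_pair_measure)
  also have "\<dots> = (\<integral>\<^sup>+ \<omega>. emeasure M {\<omega>'\<in>space M. (U \<omega>, V \<omega>') \<in> ?S} \<partial>M)"
    by (rule emeasure_indep_var_slices[OF ind]) measurable
  also have "\<dots> \<le> (\<integral>\<^sup>+ \<omega>. ennreal \<beta> + ennreal c * indicator {\<omega>\<in>space M. Q (U \<omega>)} \<omega> \<partial>M)"
  proof (intro nn_integral_mono)
    fix \<omega> assume w: "\<omega> \<in> space M"
    have "emeasure M {\<omega>'\<in>space M. (U \<omega>, V \<omega>') \<in> ?S} = emeasure M {\<omega>'\<in>space M. R (U \<omega>) (V \<omega>')}"
      using UN[OF w] VN by (intro arg_cong[where f="emeasure M"]) (auto simp: space_pair_measure)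
    also have "\<dots> = ennreal (prob {\<omega>'\<in>space M. R (U \<omega>) (V \<omega>')})"
      by (simp add: emeasure_eq_measure)
    also have "\<dots> \<le> ennreal (\<beta> + (if Q (U \<omega>) then c else 0))"
      by (intro ennreal_leI slices UN w)
    finally show "emeasure M {\<omega>'\<in>space M. (U \<omega>, V \<omega>') \<in> ?S} \<le>
        ennreal \<beta> + ennreal c * indicator {\<omega>\<in>space M. Q (U \<omega>)} \<omega>"
      using w nonneg by (auto simp: ennreal_plus split: if_splits)
  qed
  also have "\<dots> = ennreal (\<beta> + c * prob {\<omega>\<in>space M. Q (U \<omega>)})"
    using nonneg
    by (simp add: nn_integral_add nn_integral_cmult emeasure_eq_measure prob_space
        ennreal_plus ennreal_mult)
  finally show ?thesis
    using nonneg by (subst (asm) emeasure_eq_measure, subst (asm) ennreal_le_iff) auto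
qed

lemma prob_indep_var_ge:
  assumes ind: "indep_var N U L V"
    and R: "Measurable.pred (N \<Otimes>\<^sub>M L) (\<lambda>(u, v). R u v)" and Q: "Measurable.pred N Q"
    and slices: "\<And>u. u \<in> space N \<Longrightarrow> Q u \<Longrightarrow> \<alpha> \<le> prob {\<omega>\<in>space M. R u (V \<omega>)}"
    and nonneg: "0 \<le> \<alpha>"
  shows "\<alpha> * prob {\<omega>\<in>space M. Q (U \<omega>)} \<le> prob {\<omega>\<in>space M. R (U \<omega>) (V \<omega>)}"
proof -
  have U[measurable]: "U \<in> measurable M N" and V[measurable]: "V \<in> measurable M L"
    using ind by (auto simp: indep_var_distribution_eq)
  note R[measurable] Q[measurable]
  let ?S = "{p \<in> space (N \<Otimes>\<^sub>M L). case p of (u, v) \<Rightarrow> R u v}"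
  have UN: "\<omega> \<in> space M \<Longrightarrow> U \<omega> \<in> space N" and VN: "\<omega> \<in> space M \<Longrightarrow> V \<omega> \<in> space L" for \<omega>
    using measurable_space[OF U] measurable_space[OF V] by auto
  have "ennreal (\<alpha> * prob {\<omega>\<in>space M. Q (U \<omega>)}) =
      (\<integral>\<^sup>+ \<omega>. ennreal \<alpha> * indicator {\<omega>\<in>space M. Q (U \<omega>)} \<omega> \<partial>M)"
    using nonneg by (simp add: nn_integral_cmult emeasure_eq_measure ennreal_mult)
  also have "\<dots> \<le> (\<integral>\<^sup>+ \<omega>. emeasure M {\<omega>'\<in>space M. (U \<omega>, V \<omega>') \<in> ?S} \<partial>M)"
  proof (intro nn_integral_mono)
    fix \<omega> assume w: "\<omega> \<in> space M"
    have "emeasure M {\<omega>'\<in>space M. (U \<omega>, V \<omega>') \<in> ?S} = emeasure M {\<omega>'\<in>space M. R (U \<omega>) (V \<omega>')}"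
      using UN[OF w] VN by (intro arg_cong[where f="emeasure M"]) (auto simp: space_pair_measure)
    also have "\<dots> = ennreal (prob {\<omega>'\<in>space M. R (U \<omega>) (V \<omega>')})"
      by (simp add: emeasure_eq_measure)
    finally show "ennreal \<alpha> * indicator {\<omega>\<in>space M. Q (U \<omega>)} \<omega> \<le> emeasure M {\<omega>'\<in>space M. (U \<omega>, V \<omega>') \<in> ?S}"
      using slices[OF UN[OF w]] by (auto simp: indicator_def intro: ennreal_leI)
  qed
  also have "\<dots> = emeasure M {\<omega>\<in>space M. (U \<omega>, V \<omega>) \<in> ?S}"
    by (rule emeasure_indep_var_slices[OF ind, symmetric]) measurable
  also have "\<dots> = emeasure M {\<omega>\<in>space M. R (U \<omega>) (V \<omega>)}"
    using UN VN by (intro arg_cong[where f="emeasure M"]) (auto simp: space_pair_measure)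
  finally show ?thesis
    by (simp add: emeasure_eq_measure)
qed

text \<open>Steps outside the index set become 0 rather than \<open>undefined\<close>, as
  \<open>restrict\<close> would have it. Partial sums and maxima then apply unchanged to each
  portion of the walk, and all portions live on the single space \<open>PiM UNIV\<close>.
  Independence is that of the restrictions, composed with the extension by 0.\<close>

lemma indep_var_zero_outside:
  fixes \<xi> :: "'i \<Rightarrow> 'a \<Rightarrow> real"
  assumes "indep_vars (\<lambda>_. borel) \<xi> I" "A \<inter> K = {}" "A \<subseteq> I" "K \<subseteq> I"
  shows "indep_var (PiM UNIV (\<lambda>_. borel)) (zero_outside A \<xi>) (PiM UNIV (\<lambda>_. borel)) (zero_outside K \<xi>)"
proof -
  have [measurable]: "(\<lambda>f i. if i \<in> B then f i else 0) \<in>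
      measurable (PiM B (\<lambda>_. borel :: real measure)) (PiM UNIV (\<lambda>_. borel :: real measure))" for B :: "'i set"
  proof (rule measurable_PiM_single')
    fix i show "(\<lambda>f. if i \<in> B then f i else 0) \<in> borel_measurable (PiM B (\<lambda>_. borel :: real measure))"
      by (cases "i \<in> B") auto
  qed auto
  have "indep_var (PiM UNIV (\<lambda>_. borel)) ((\<lambda>f i. if i \<in> A then f i else 0) \<circ> (\<lambda>\<omega>. restrict (\<lambda>i. \<xi> i \<omega>) A))
    (PiM UNIV (\<lambda>_. borel)) ((\<lambda>f i. if i \<in> K then f i else 0) \<circ> (\<lambda>\<omega>. restrict (\<lambda>i. \<xi> i \<omega>) K))"
    using indep_var_restrict[OF assms] by (rule indep_var_compose) measurable
  then show ?thesis
    by (simp add: comp_def zero_outside_def[abs_def] cong: if_cong)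
qed

lemma measurable_zero_outside:
  fixes \<xi> :: "'i \<Rightarrow> 'a \<Rightarrow> real"
  assumes "indep_vars (\<lambda>_. borel) \<xi> I" "A \<subseteq> I"
  shows "zero_outside A \<xi> \<in> measurable M (PiM UNIV (\<lambda>_. borel))"
  using indep_var_zero_outside[OF assms(1), of A "{}"] assms(2) by (auto dest: indep_var_rv1)

end

subsection \<open>The maximum of a deterministic walk\<close>

definition walk_max :: "nat \<Rightarrow> (nat \<Rightarrow> real) \<Rightarrow> real" where
  "walk_max n x = Max ((\<lambda>k. sum x {..<k}) ` {..n})"

definition walk_max_after :: "nat \<Rightarrow> nat \<Rightarrow> (nat \<Rightarrow> real) \<Rightarrow> real" where
  "walk_max_after j n x = Max ((\<lambda>k. sum x {..<k}) ` {j<..n})"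

text \<open>
  \<open>k\<close> is a first maximum among the indices \<open>i > j\<close>, and seen backwards from \<open>k\<close> the walk first
  descends by \<open>b\<close> at \<open>j\<close>; only the steps with index at least \<open>j\<close> matter.
\<close>

definition late_ascent :: "real \<Rightarrow> nat \<Rightarrow> nat \<Rightarrow> nat \<Rightarrow> (nat \<Rightarrow> real) \<Rightarrow> bool" where
  "late_ascent b n j k x \<longleftrightarrow>
     b \<le> sum x {..<k} - sum x {..<j} \<and>
     (\<forall>i\<in>{j<..<k}. sum x {..<i} < sum x {..<k} \<and> sum x {..<k} - sum x {..<i} < b) \<and>
     (\<forall>i\<in>{k<..n}. sum x {..<i} \<le> sum x {..<k})"

text \<open>A named functional gives \<open>measurable\<close> a rule to apply; prefix sums are
  folded into it before the method runs.\<close>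

definition partial_sum :: "nat \<Rightarrow> (nat \<Rightarrow> real) \<Rightarrow> real" where
  "partial_sum k x = sum x {..<k}"

lemma measurable_partial_sum [measurable]:
  "partial_sum k \<in> borel_measurable (PiM UNIV (\<lambda>_. borel :: real measure))"
  unfolding partial_sum_def
  by (intro borel_measurable_sum measurable_component_singleton) auto

lemma measurable_walk_max_after [measurable]:
  "walk_max_after j n \<in> borel_measurable (PiM UNIV (\<lambda>_. borel :: real measure))"
  unfolding walk_max_after_def partial_sum_def[symmetric]
  by (intro borel_measurable_Max measurable_partial_sum) auto

lemma pred_late_ascent [measurable]:
  "Measurable.pred (PiM UNIV (\<lambda>_. borel :: real measure)) (late_ascent b n j k)"
proof -
  have pred_le: "Measurable.pred N (\<lambda>x. u x \<le> v x)"
    if "u \<in> borel_measurable N" "v \<in> borel_measurable N" for u v :: "'b \<Rightarrow> real" and N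
    unfolding Measurable.pred_def using that by (rule borel_measurable_le)
  show ?thesis
    unfolding late_ascent_def partial_sum_def[symmetric]
    by (intro pred_intros_logic pred_intros_finite pred_le borel_measurable_pred_less
        measurable_partial_sum borel_measurable_diff measurable_const) auto
qed

lemma walk_max_ge: "k \<le> n \<Longrightarrow> sum x {..<k} \<le> walk_max n x"
  unfolding walk_max_def by (rule Max_ge) auto

lemma walk_max_le_iff: "walk_max n x \<le> c \<longleftrightarrow> (\<forall>k\<le>n. sum x {..<k} \<le> c)"
  unfolding walk_max_def by (subst Max_le_iff) auto

lemma walk_max_attained:
  obtains k where "k \<le> n" "sum x {..<k} = walk_max n x"
proof -
  have "walk_max n x \<in> (\<lambda>k. sum x {..<k}) ` {..n}"
    unfolding walk_max_def by (rule Max_in) auto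
  then show ?thesis using that by auto
qed

lemma walk_max_after_ge: "j < k \<Longrightarrow> k \<le> n \<Longrightarrow> sum x {..<k} \<le> walk_max_after j n x"
  unfolding walk_max_after_def by (rule Max_ge) auto

lemma walk_max_after_attained:
  assumes "j < n"
  obtains k where "j < k" "k \<le> n" "sum x {..<k} = walk_max_after j n x"
proof -
  have "walk_max_after j n x \<in> (\<lambda>k. sum x {..<k}) ` {j<..n}"
    unfolding walk_max_after_def using assms by (intro Max_in) auto
  then show ?thesis using that by auto
qed

lemma walk_max_after_cong:
  assumes "\<And>i. i < n \<Longrightarrow> x i = y i"
  shows "walk_max_after j n x = walk_max_after j n y"
  unfolding walk_max_after_def
  using assms by (intro arg_cong[where f=Max] image_cong sum.cong) auto

text \<open>Up to \<open>j\<close> the walk stays less than \<open>b\<close> above its value at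
  \<open>j\<close>, whereas at \<open>k\<close> it is at least \<open>b\<close> above that value;
  between \<open>j\<close> and \<open>k\<close>, and after \<open>k\<close>,
  \<open>late_ascent\<close> itself makes the comparison. So a local description becomes a global
  one: \<open>k\<close> is the first argmax.\<close>

lemma late_ascent_walk_max:
  assumes "late_ascent b n j k x" "0 < b" "j < k" "k \<le> n"
    and low: "\<And>i. i \<le> j \<Longrightarrow> sum x {..<i} - sum x {..<j} < b"
  shows "i < k \<Longrightarrow> sum x {..<i} < sum x {..<k}" and "walk_max n x = sum x {..<k}"
proof -
  have less: "sum x {..<i} < sum x {..<k}" if "i < k" for i
    using that assms(1) low[of i] unfolding late_ascent_def by (cases "i \<le> j") auto
  then show "i < k \<Longrightarrow> sum x {..<i} < sum x {..<k}" .
  have "sum x {..<i} \<le> sum x {..<k}" if "i \<le> n" for i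
    using that less[of i] assms(1) unfolding late_ascent_def
    by (cases i k rule: linorder_cases) auto
  then show "walk_max n x = sum x {..<k}"
    by (intro antisym) (auto simp: walk_max_le_iff intro: walk_max_ge assms)
qed

text \<open>Both \<open>k\<close> and \<open>k'\<close> are the first argmax, hence equal; then
  \<open>j\<close> and \<open>j'\<close> are both the last index before it at which the walk is at
  least \<open>b\<close> lower. This is the disjointness that lets ascent probabilities be added
  up.\<close>

lemma late_ascent_unique:
  assumes A: "late_ascent b n j k x" "j < k" "k \<le> n" "\<And>i. i \<le> j \<Longrightarrow> sum x {..<i} - sum x {..<j} < b"
    and B: "late_ascent b n j' k' x" "j' < k'" "k' \<le> n" "\<And>i. i \<le> j' \<Longrightarrow> sum x {..<i} - sum x {..<j'} < b"
    and b: "0 < b"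
  shows "(j, k) = (j', k')"
proof -
  have eq: "sum x {..<k} = sum x {..<k'}"
    using late_ascent_walk_max(2)[OF A(1) b A(2-4)] late_ascent_walk_max(2)[OF B(1) b B(2-4)] by simp
  have k: "k = k'"
  proof (rule ccontr)
    assume "k \<noteq> k'"
    then show False
      using late_ascent_walk_max(1)[OF A(1) b A(2-4), of k'] late_ascent_walk_max(1)[OF B(1) b B(2-4), of k] eq
      by linarith
  qed
  have asc: "b \<le> sum x {..<k} - sum x {..<j}" "b \<le> sum x {..<k} - sum x {..<j'}"
      "\<And>i. j < i \<Longrightarrow> i < k \<Longrightarrow> sum x {..<k} - sum x {..<i} < b"
      "\<And>i. j' < i \<Longrightarrow> i < k \<Longrightarrow> sum x {..<k} - sum x {..<i} < b"
    using A(1) B(1) unfolding k late_ascent_def by auto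
  have "\<not> j < j'" "\<not> j' < j"
    using asc(3)[of j'] asc(4)[of j] asc(1,2) A(2) B(2) k by auto
  then have "j = j'" by simp
  with k show ?thesis by simp
qed

text \<open>
  With \<open>k\<close> the first argmax and \<open>j\<close> the last index before \<open>k\<close> at which the walk is at least \<open>2a\<close>
  below its maximum, either the walk is already high at \<open>j\<close> or step \<open>j\<close> is a large jump.
\<close>

lemma walk_max_cases:
  fixes x :: "nat \<Rightarrow> real"
  assumes a: "0 < a" and high: "4 * a \<le> walk_max n x"
  obtains
    (jump) j where "j < n" "a \<le> x j" "walk_max n x = x j + walk_max_after j n (x(j := 0))"
  | (ascent) j k where "j < k" "k \<le> n" "late_ascent (2 * a) n j k x"
      "a \<le> sum x {..<j}" "walk_max n x = sum x {..<k}"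
proof -
  define k where "k = (LEAST k. k \<le> n \<and> sum x {..<k} = walk_max n x)"
  have ex: "\<exists>k. k \<le> n \<and> sum x {..<k} = walk_max n x"
    using walk_max_attained by metis
  have k: "k \<le> n" "sum x {..<k} = walk_max n x"
    using LeastI_ex[OF ex] by (auto simp: k_def)
  have before: "sum x {..<i} < sum x {..<k}" if "i < k" for i
  proof -
    have "\<not> (i \<le> n \<and> sum x {..<i} = walk_max n x)"
      using not_less_Least that unfolding k_def by blast
    then show ?thesis using walk_max_ge[of i n x] that k by auto
  qed
  have k0: "0 < k" using high a k by (cases k) auto
  define J where "J = {j. j < k \<and> 2 * a \<le> sum x {..<k} - sum x {..<j}}"
  have "finite J" "0 \<in> J" using k0 high a k by (auto simp: J_def)
  define j where "j = Max J"
  have "j \<in> J" unfolding j_def using \<open>finite J\<close> \<open>0 \<in> J\<close> by (intro Max_in) auto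
  then have j: "j < k" "2 * a \<le> sum x {..<k} - sum x {..<j}" by (auto simp: J_def)
  have last: "sum x {..<k} - sum x {..<i} < 2 * a" if "j < i" "i < k" for i
  proof (rule ccontr)
    assume "\<not> sum x {..<k} - sum x {..<i} < 2 * a"
    then have "i \<in> J" using that by (simp add: J_def)
    then show False using Max_ge[OF \<open>finite J\<close>, of i] that unfolding j_def by simp
  qed
  have asc: "late_ascent (2 * a) n j k x"
    unfolding late_ascent_def using j last before walk_max_ge[of _ n x] k by auto
  show ?thesis
  proof (cases "a \<le> sum x {..<j}")
    case True
    then show ?thesis using ascent asc j k by auto
  next
    case False
    \<comment> \<open>The origin of \<open>4 * a\<close>: right after \<open>j\<close> the walk is
      within \<open>2 * a\<close> of a maximum of at least \<open>4 * a\<close>, so above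
      \<open>2 * a\<close>, while at \<open>j\<close> it is below \<open>a\<close>. Step
      \<open>j\<close> must bridge the gap. If \<open>Suc j = k\<close>, the difference is
      0.\<close>
    have "sum x {..<k} - sum x {..<Suc j} < 2 * a"
    proof (cases "Suc j = k")
      case True then show ?thesis using a by auto
    next
      case False then show ?thesis using last[of "Suc j"] j by auto
    qed
    then have xj: "a \<le> x j" using False high k by simp
    \<comment> \<open>Deleting step \<open>j\<close> lowers all later partial sums by the same
      \<open>x j\<close>, so the maximum splits into \<open>x j\<close> and a quantity determined by
      the other steps.\<close>
    have split: "sum x {..<i} = x j + sum (x(j := 0)) {..<i}" if "j < i" for i
    proof -
      have "sum x {..<i} = x j + sum x ({..<i} - {j})"
        using that by (subst sum.remove[of _ j]) auto
      moreover have "sum (x(j := 0)) {..<i} = (x(j := 0)) j + sum (x(j := 0)) ({..<i} - {j})"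
        using that by (subst sum.remove[of _ j]) auto
      moreover have "sum (x(j := 0)) ({..<i} - {j}) = sum x ({..<i} - {j})"
        by (intro sum.cong) auto
      ultimately show ?thesis by simp
    qed
    have "walk_max n x = x j + walk_max_after j n (x(j := 0))"
    proof (rule antisym)
      show "walk_max n x \<le> x j + walk_max_after j n (x(j := 0))"
        using walk_max_after_ge[of j k n "x(j := 0)"] split[of k] j k by simp
      have "j < n" using j k by auto
      then obtain i where i: "j < i" "i \<le> n" "sum (x(j := 0)) {..<i} = walk_max_after j n (x(j := 0))"
        by (rule walk_max_after_attained)
      then show "x j + walk_max_after j n (x(j := 0)) \<le> walk_max n x"
        using walk_max_ge[of i n x] split[of i] by simp
    qed
    with xj j k show ?thesis by (intro jump[of j]) auto
  qed
qed

subsection \<open>The maximum of a random walk with independent steps\<close>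

lemma sum_zero_outside:
  fixes \<xi> :: "nat \<Rightarrow> 'a \<Rightarrow> real"
  shows "sum (zero_outside A \<xi> \<omega>) {..<k} = (\<Sum>i\<in>{..<k} \<inter> A. \<xi> i \<omega>)"
  unfolding zero_outside_def by (simp add: sum.inter_restrict)

lemma sum_zero_outside_all:
  fixes \<xi> :: "nat \<Rightarrow> 'a \<Rightarrow> real"
  assumes "k \<le> n"
  shows "sum (zero_outside {..<n} \<xi> \<omega>) {..<k} = (\<Sum>i<k. \<xi> i \<omega>)"
proof -
  have "{..<k} \<inter> {..<n} = {..<k}" using assms by auto
  then show ?thesis by (simp add: sum_zero_outside)
qed

lemma sum_zero_outside_first:
  fixes \<xi> :: "nat \<Rightarrow> 'a \<Rightarrow> real"
  assumes "k \<le> j"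
  shows "sum (zero_outside {..<j} \<xi> \<omega>) {..<k} = (\<Sum>i<k. \<xi> i \<omega>)"
  using sum_zero_outside_all[OF assms] .

lemma sum_zero_outside_last:
  fixes \<xi> :: "nat \<Rightarrow> 'a \<Rightarrow> real"
  assumes "k \<le> n"
  shows "sum (zero_outside {j..<n} \<xi> \<omega>) {..<k} = (if k \<le> j then 0 else (\<Sum>i<k. \<xi> i \<omega>) - (\<Sum>i<j. \<xi> i \<omega>))"
proof (cases "k \<le> j")
  case True
  then have "{..<k} \<inter> {j..<n} = {}" by auto
  with True show ?thesis by (simp add: sum_zero_outside)
next
  case False
  have "(\<Sum>i\<in>{..<k} - {..<j}. \<xi> i \<omega>) = (\<Sum>i<k. \<xi> i \<omega>) - (\<Sum>i<j. \<xi> i \<omega>)"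
    using False by (intro sum_diff) auto
  moreover have "{..<k} \<inter> {j..<n} = {..<k} - {..<j}" using assms by auto
  ultimately show ?thesis using False by (simp only: sum_zero_outside if_False)
qed

lemma sum_zero_outside_remove:
  fixes \<xi> :: "nat \<Rightarrow> 'a \<Rightarrow> real"
  assumes "k \<le> n" "j < n"
  shows "sum (zero_outside ({..<n} - {j}) \<xi> \<omega>) {..<k} = (\<Sum>i<k. \<xi> i \<omega>) - (if j < k then \<xi> j \<omega> else 0)"
proof -
  have "{..<k} \<inter> ({..<n} - {j}) = {..<k} - {j}" using assms by auto
  then show ?thesis by (simp add: sum_zero_outside sum_diff1)
qed

text \<open>Only differences of partial sums at indices from \<open>j\<close> on are compared, and
  dropping the steps before \<open>j\<close> shifts all of these sums by the same amount.\<close>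

lemma late_ascent_zero_outside:
  assumes "j < k" "k \<le> n"
  shows "late_ascent b n j k (zero_outside {j..<n} \<xi> \<omega>) \<longleftrightarrow> late_ascent b n j k (\<lambda>i. \<xi> i \<omega>)"
proof -
  have "late_ascent b n j k (zero_outside {j..<n} \<xi> \<omega>) \<longleftrightarrow>
     b \<le> (\<Sum>i<k. \<xi> i \<omega>) - (\<Sum>i<j. \<xi> i \<omega>) \<and>
     (\<forall>i\<in>{j<..<k}. (\<Sum>i<i. \<xi> i \<omega>) < (\<Sum>i<k. \<xi> i \<omega>) \<and> (\<Sum>i<k. \<xi> i \<omega>) - (\<Sum>i<i. \<xi> i \<omega>) < b) \<and>
     (\<forall>i\<in>{k<..n}. (\<Sum>i<i. \<xi> i \<omega>) \<le> (\<Sum>i<k. \<xi> i \<omega>))"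
    unfolding late_ascent_def using assms
    by (intro arg_cong2[where f="(\<and>)"] ball_cong refl) (auto simp: sum_zero_outside_last)
  then show ?thesis unfolding late_ascent_def by simp
qed

context prob_space
begin

section \<open>Walks whose partial sums rarely leave [-\<eta>, \<eta>]\<close>

context
  fixes \<xi> :: "nat \<Rightarrow> 'a \<Rightarrow> real" and n :: nat and \<eta> \<theta> :: real
  assumes indep: "indep_vars (\<lambda>_. borel) \<xi> {..<n}"
    and \<eta>: "0 < \<eta>"
    and small: "prob {\<omega>\<in>space M. \<exists>k\<le>n. \<eta> < \<bar>\<Sum>i<k. \<xi> i \<omega>\<bar>} \<le> \<theta>"
begin

private lemma rv [measurable]: "i < n \<Longrightarrow> \<xi> i \<in> borel_measurable M"
  using indep unfolding indep_vars_def by auto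

private lemma rv_sum [measurable]: "k \<le> n \<Longrightarrow> (\<lambda>\<omega>. \<Sum>i<k. \<xi> i \<omega>) \<in> borel_measurable M"
  by (intro borel_measurable_sum rv) auto

private lemma large_event [measurable]: "{\<omega>\<in>space M. \<exists>k\<le>n. \<eta> < \<bar>\<Sum>i<k. \<xi> i \<omega>\<bar>} \<in> events"
proof -
  have "{\<omega>\<in>space M. \<exists>k\<le>n. \<eta> < \<bar>\<Sum>i<k. \<xi> i \<omega>\<bar>} =
      (\<Union>k\<in>{..n}. {\<omega>\<in>space M. \<eta> < \<bar>\<Sum>i<k. \<xi> i \<omega>\<bar>})"
    by auto
  also have "\<dots> \<in> events"
    by (intro sets.finite_UN) auto
  finally show ?thesis .
qed

private lemma rv_walk_max: "(\<lambda>\<omega>. walk_max n (\<lambda>i. \<xi> i \<omega>)) \<in> borel_measurable M"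
  unfolding walk_max_def by (intro borel_measurable_Max rv_sum) auto

text \<open>The factor 3: the removed step is the difference of two consecutive partial sums, so at
  most three partial sums enter, each of modulus at most \<open>\<eta>\<close>.\<close>

private lemma abs_partial_sum_removed:
  assumes "j < n" "k \<le> n" "\<And>k. k \<le> n \<Longrightarrow> \<bar>\<Sum>i<k. \<xi> i \<omega>\<bar> \<le> \<eta>"
  shows "\<bar>sum (zero_outside ({..<n} - {j}) \<xi> \<omega>) {..<k}\<bar> \<le> 3 * \<eta>"
  using assms(3)[of j] assms(3)[of "Suc j"] assms(3)[of k] assms(1,2)
  by (auto simp: sum_zero_outside_remove)

private lemma prob_large_removed:
  assumes "j < n"
  shows "prob {\<omega>\<in>space M. \<not> (\<forall>k\<le>n. \<bar>sum (zero_outside ({..<n} - {j}) \<xi> \<omega>) {..<k}\<bar> \<le> 3 * \<eta>)} \<le> \<theta>"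
proof -
  have "prob {\<omega>\<in>space M. \<not> (\<forall>k\<le>n. \<bar>sum (zero_outside ({..<n} - {j}) \<xi> \<omega>) {..<k}\<bar> \<le> 3 * \<eta>)} \<le>
      prob {\<omega>\<in>space M. \<exists>k\<le>n. \<eta> < \<bar>\<Sum>i<k. \<xi> i \<omega>\<bar>}"
  proof (intro finite_measure_mono large_event subsetI)
    fix \<omega> assume w: "\<omega> \<in> {\<omega>\<in>space M. \<not> (\<forall>k\<le>n. \<bar>sum (zero_outside ({..<n} - {j}) \<xi> \<omega>) {..<k}\<bar> \<le> 3 * \<eta>)}"
    have "\<exists>k\<le>n. \<eta> < \<bar>\<Sum>i<k. \<xi> i \<omega>\<bar>"
    proof (rule ccontr)
      assume "\<not> (\<exists>k\<le>n. \<eta> < \<bar>\<Sum>i<k. \<xi> i \<omega>\<bar>)"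
      then have "\<And>k. k \<le> n \<Longrightarrow> \<bar>\<Sum>i<k. \<xi> i \<omega>\<bar> \<le> \<eta>" by (meson not_less)
      from abs_partial_sum_removed[OF assms _ this] w show False by blast
    qed
    with w show "\<omega> \<in> {\<omega>\<in>space M. \<exists>k\<le>n. \<eta> < \<bar>\<Sum>i<k. \<xi> i \<omega>\<bar>}" by blast
  qed
  with small show ?thesis by simp
qed

private lemma indep_removed:
  assumes "j < n"
  shows "indep_var (PiM UNIV (\<lambda>_. borel)) (zero_outside ({..<n} - {j}) \<xi>)
    (PiM UNIV (\<lambda>_. borel)) (zero_outside {j} \<xi>)"
  using assms by (intro indep_var_zero_outside[OF indep]) auto

text \<open>Condition on all steps except \<open>j\<close>: the maximum after the jump becomes a
  constant \<open>g\<close>. Unless the remaining walk leaves [-3\<eta>, 3\<eta>], which has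
  probability at most \<open>\<theta>\<close>, the sharp bound \<open>\<beta>\<close> applies to
  this \<open>g\<close>; otherwise the crude bound \<open>c\<close> does.\<close>

private lemma prob_single_jump_le:
  assumes j: "j < n" and B[measurable]: "B \<in> sets borel"
    and step: "\<And>g. \<bar>g\<bar> \<le> 3 * \<eta> \<Longrightarrow> prob {\<omega>\<in>space M. a \<le> \<xi> j \<omega> \<and> \<xi> j \<omega> + g \<in> B} \<le> \<beta>"
    and step': "\<And>g. prob {\<omega>\<in>space M. a \<le> \<xi> j \<omega> \<and> \<xi> j \<omega> + g \<in> B} \<le> c"
    and nonneg: "0 \<le> \<beta>" "0 \<le> c"
  shows "prob {\<omega>\<in>space M. a \<le> \<xi> j \<omega> \<and> \<xi> j \<omega> + walk_max_after j n (zero_outside ({..<n} - {j}) \<xi> \<omega>) \<in> B}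
    \<le> \<beta> + c * \<theta>"
proof -
  let ?U = "zero_outside ({..<n} - {j}) \<xi>"
  define Q where "Q u \<longleftrightarrow> \<not> (\<forall>k\<le>n. \<bar>sum u {..<k}\<bar> \<le> 3 * \<eta>)" for u :: "nat \<Rightarrow> real"
  have "prob {\<omega>\<in>space M. (\<lambda>u v. a \<le> v j \<and> v j + walk_max_after j n u \<in> B) (?U \<omega>) (zero_outside {j} \<xi> \<omega>)}
      \<le> \<beta> + c * prob {\<omega>\<in>space M. Q (?U \<omega>)}"
  proof (rule prob_indep_var_le[OF indep_removed[OF j]])
    show "Measurable.pred (PiM UNIV (\<lambda>_. borel)) Q"
      unfolding Q_def partial_sum_def[symmetric] by measurable
    fix u :: "nat \<Rightarrow> real"
    show "prob {\<omega>\<in>space M. a \<le> zero_outside {j} \<xi> \<omega> j \<and> zero_outside {j} \<xi> \<omega> j + walk_max_after j n u \<in> B}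
        \<le> \<beta> + (if Q u then c else 0)"
    proof (cases "Q u")
      case True
      then show ?thesis using step'[of "walk_max_after j n u"] nonneg by (simp add: zero_outside_def)
    next
      case False
      obtain k where "k \<le> n" "sum u {..<k} = walk_max_after j n u"
        using walk_max_after_attained[OF j] by metis
      then have "\<bar>walk_max_after j n u\<bar> \<le> 3 * \<eta>"
        using False unfolding Q_def by auto
      then show ?thesis using step[of "walk_max_after j n u"] False by (simp add: zero_outside_def)
    qed
  qed (use nonneg in measurable)
  also have "\<dots> \<le> \<beta> + c * \<theta>"
    using prob_large_removed[OF j] nonneg unfolding Q_def
    by (intro add_left_mono mult_left_mono) auto
  finally show ?thesis by (simp add: zero_outside_def)
qed

text \<open>
  The event that the steps before \<open>j\<close> never take the walk to a height \<open>b\<close> above its value at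
  \<open>j\<close> is independent of the late ascent and has probability at least \<open>1/2\<close>; on the intersections,
  which are disjoint, \<open>k\<close> is the first argmax and the walk has left \<open>[-\<eta>, \<eta>]\<close>.
\<close>

private lemma sum_prob_late_ascent_le:
  assumes \<theta>: "\<theta> \<le> 1 / 2" and b: "2 * \<eta> < b"
  shows "(\<Sum>(j, k)\<in>{(j, k). j < k \<and> k \<le> n}. prob {\<omega>\<in>space M. late_ascent b n j k (zero_outside {j..<n} \<xi> \<omega>)})
    \<le> 2 * \<theta>"
proof -
  define P where "P = {(j, k). j < k \<and> k \<le> n}"
  have "P \<subseteq> {..n} \<times> {..n}" by (auto simp: P_def)
  then have finP: "finite P" by (rule finite_subset) auto
  define F where "F j v \<longleftrightarrow> (\<forall>i\<le>j. sum v {..<i} - sum v {..<j} < b)" for j :: nat and v :: "nat \<Rightarrow> real"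
  have [measurable]: "Measurable.pred (PiM UNIV (\<lambda>_. borel)) (F j)" for j
    unfolding F_def partial_sum_def[symmetric] by measurable
  define G where "G = (\<lambda>(j, k). {\<omega>\<in>space M. late_ascent b n j k (zero_outside {j..<n} \<xi> \<omega>) \<and> F j (zero_outside {..<j} \<xi> \<omega>)})"
  have F_iff: "F j (zero_outside {..<j} \<xi> \<omega>) \<longleftrightarrow> F j (\<lambda>i. \<xi> i \<omega>)" for j \<omega>
    unfolding F_def by (auto simp: sum_zero_outside_first)
  have Gm[measurable]: "G p \<in> events" if pP: "p \<in> P" for p
  proof -
    obtain j k where p: "p = (j, k)" "j < k" "k \<le> n" using pP unfolding P_def by auto
    have [measurable]: "zero_outside {j..<n} \<xi> \<in> measurable M (PiM UNIV (\<lambda>_. borel))"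
      "zero_outside {..<j} \<xi> \<in> measurable M (PiM UNIV (\<lambda>_. borel))"
      using p by (auto intro!: measurable_zero_outside[OF indep])
    show ?thesis unfolding G_def p by simp
  qed
  have half: "1 / 2 * prob {\<omega>\<in>space M. late_ascent b n j k (zero_outside {j..<n} \<xi> \<omega>)} \<le> prob (G (j, k))"
    if "(j, k) \<in> P" for j k
  proof -
    have jk: "j < k" "k \<le> n" using that by (auto simp: P_def)
    have [measurable]: "zero_outside {..<j} \<xi> \<in> measurable M (PiM UNIV (\<lambda>_. borel))"
      using jk by (intro measurable_zero_outside[OF indep]) auto
    have ind: "indep_var (PiM UNIV (\<lambda>_. borel)) (zero_outside {j..<n} \<xi>) (PiM UNIV (\<lambda>_. borel)) (zero_outside {..<j} \<xi>)"
      using jk by (intro indep_var_zero_outside[OF indep]) auto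
    have "1 - \<theta> \<le> 1 - prob {\<omega>\<in>space M. \<exists>k\<le>n. \<eta> < \<bar>\<Sum>i<k. \<xi> i \<omega>\<bar>}"
      using small by simp
    also have "\<dots> = prob (space M - {\<omega>\<in>space M. \<exists>k\<le>n. \<eta> < \<bar>\<Sum>i<k. \<xi> i \<omega>\<bar>})"
      by (intro prob_compl[symmetric]) measurable
    also have "\<dots> \<le> prob {\<omega>\<in>space M. F j (zero_outside {..<j} \<xi> \<omega>)}"
    proof (intro finite_measure_mono subsetI)
      fix \<omega> assume w: "\<omega> \<in> space M - {\<omega>\<in>space M. \<exists>k\<le>n. \<eta> < \<bar>\<Sum>i<k. \<xi> i \<omega>\<bar>}"
      have "(\<Sum>l<i. \<xi> l \<omega>) - (\<Sum>l<j. \<xi> l \<omega>) < b" if "i \<le> j" for i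
      proof -
        have "\<bar>\<Sum>l<i. \<xi> l \<omega>\<bar> \<le> \<eta>" "\<bar>\<Sum>l<j. \<xi> l \<omega>\<bar> \<le> \<eta>"
          using w jk that by (auto simp: not_less)
        then show ?thesis using b by linarith
      qed
      then have "F j (\<lambda>i. \<xi> i \<omega>)" by (simp add: F_def)
      then show "\<omega> \<in> {\<omega>\<in>space M. F j (zero_outside {..<j} \<xi> \<omega>)}"
        using w by (simp add: F_iff)
    qed measurable
    finally have pF: "1 / 2 \<le> prob {\<omega>\<in>space M. F j (zero_outside {..<j} \<xi> \<omega>)}"
      using \<theta> by simp
    have "1 / 2 * prob {\<omega>\<in>space M. late_ascent b n j k (zero_outside {j..<n} \<xi> \<omega>)} \<le>
        prob {\<omega>\<in>space M. (\<lambda>u v. late_ascent b n j k u \<and> F j v) (zero_outside {j..<n} \<xi> \<omega>) (zero_outside {..<j} \<xi> \<omega>)}"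
      by (rule prob_indep_var_ge[OF ind]) (use pF in auto)
    then show ?thesis by (simp add: G_def)
  qed
  have G_ascent: "late_ascent b n j k (\<lambda>i. \<xi> i \<omega>)" "\<And>i. i \<le> j \<Longrightarrow> (\<Sum>l<i. \<xi> l \<omega>) - (\<Sum>l<j. \<xi> l \<omega>) < b"
    if "(j, k) \<in> P" "\<omega> \<in> G (j, k)" for j k \<omega>
  proof -
    have "late_ascent b n j k (\<lambda>i. \<xi> i \<omega>)" "F j (\<lambda>i. \<xi> i \<omega>)"
      using that by (auto simp: G_def P_def late_ascent_zero_outside F_iff)
    then show "late_ascent b n j k (\<lambda>i. \<xi> i \<omega>)" "\<And>i. i \<le> j \<Longrightarrow> (\<Sum>l<i. \<xi> l \<omega>) - (\<Sum>l<j. \<xi> l \<omega>) < b"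
      by (auto simp: F_def)
  qed
  have disj: "disjoint_family_on G P"
    unfolding disjoint_family_on_def
  proof (intro ballI impI equals0I)
    fix p p' \<omega> assume p: "p \<in> P" "p' \<in> P" "p \<noteq> p'" and w: "\<omega> \<in> G p \<inter> G p'"
    obtain j k j' k' where jk: "p = (j, k)" "p' = (j', k')" by fastforce
    have "(j, k) = (j', k')"
      using p w G_ascent[of j k \<omega>] G_ascent[of j' k' \<omega>] \<eta> b unfolding jk
      by (intro late_ascent_unique[of b n j k "\<lambda>i. \<xi> i \<omega>"]) (auto simp: P_def)
    then show False using p jk by simp
  qed
  \<comment> \<open>Independence costs a factor 1/2 for each pair; in return the intersections are
    disjoint and lie in one event of probability at most \<open>\<theta>\<close>.\<close>
  have "1 / 2 * (\<Sum>(j, k)\<in>P. prob {\<omega>\<in>space M. late_ascent b n j k (zero_outside {j..<n} \<xi> \<omega>)}) \<le> (\<Sum>p\<in>P. prob (G p))"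
    unfolding sum_distrib_left using half by (intro sum_mono) auto
  also have "\<dots> = prob (\<Union>p\<in>P. G p)"
    using finP disj Gm by (intro finite_measure_finite_Union[symmetric]) auto
  also have "\<dots> \<le> prob {\<omega>\<in>space M. \<exists>k\<le>n. \<eta> < \<bar>\<Sum>i<k. \<xi> i \<omega>\<bar>}"
  proof (intro finite_measure_mono large_event subsetI)
    fix \<omega> assume "\<omega> \<in> (\<Union>p\<in>P. G p)"
    then obtain j k where jk: "(j, k) \<in> P" "\<omega> \<in> G (j, k)" by auto
    then have "b \<le> (\<Sum>i<k. \<xi> i \<omega>) - (\<Sum>i<j. \<xi> i \<omega>)"
      using G_ascent(1) unfolding late_ascent_def by blast
    then have "\<eta> < \<bar>\<Sum>i<k. \<xi> i \<omega>\<bar> \<or> \<eta> < \<bar>\<Sum>i<j. \<xi> i \<omega>\<bar>"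
      using b by linarith
    moreover have "\<omega> \<in> space M" "j \<le> n" "k \<le> n" using jk by (auto simp: G_def P_def)
    ultimately show "\<omega> \<in> {\<omega>\<in>space M. \<exists>k\<le>n. \<eta> < \<bar>\<Sum>i<k. \<xi> i \<omega>\<bar>}" by auto
  qed
  finally show ?thesis using small unfolding P_def by simp
qed

text \<open>A union bound over the two cases for the maximum. In the application
  \<open>\<beta>\<close> and \<open>c\<close> are of order t/n, so the factor \<open>n\<close> is
  harmless, while \<open>d\<close> is of order t and is multiplied by the summed ascent
  probabilities, not by the number of pairs.\<close>

lemma prob_walk_max_le:
  assumes a: "\<eta> < a" and \<theta>: "\<theta> \<le> 1 / 2"
    and B[measurable]: "B \<in> sets borel" and B_high: "B \<subseteq> {4 * a..}"
    and step: "\<And>j g. j < n \<Longrightarrow> \<bar>g\<bar> \<le> 3 * \<eta> \<Longrightarrow> prob {\<omega>\<in>space M. a \<le> \<xi> j \<omega> \<and> \<xi> j \<omega> + g \<in> B} \<le> \<beta>"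
    and step': "\<And>j g. j < n \<Longrightarrow> prob {\<omega>\<in>space M. a \<le> \<xi> j \<omega> \<and> \<xi> j \<omega> + g \<in> B} \<le> c"
    and walk: "\<And>j g. j < n \<Longrightarrow> prob {\<omega>\<in>space M. a \<le> (\<Sum>i<j. \<xi> i \<omega>) \<and> (\<Sum>i<j. \<xi> i \<omega>) + g \<in> B} \<le> d"
    and nonneg: "0 \<le> \<beta>" "0 \<le> c" "0 \<le> d"
  shows "prob {\<omega>\<in>space M. walk_max n (\<lambda>i. \<xi> i \<omega>) \<in> B} \<le> n * (\<beta> + c * \<theta>) + d * (2 * \<theta>)"
proof -
  define P where "P = {(j, k). j < k \<and> k \<le> n}"
  have "P \<subseteq> {..n} \<times> {..n}" by (auto simp: P_def)
  then have finP: "finite P" by (rule finite_subset) auto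
  define J where "J j = {\<omega>\<in>space M. a \<le> \<xi> j \<omega> \<and> \<xi> j \<omega> + walk_max_after j n (zero_outside ({..<n} - {j}) \<xi> \<omega>) \<in> B}" for j
  define A where "A = (\<lambda>(j, k). {\<omega>\<in>space M. late_ascent (2 * a) n j k (zero_outside {j..<n} \<xi> \<omega>) \<and>
    a \<le> (\<Sum>i<j. \<xi> i \<omega>) \<and> (\<Sum>i<k. \<xi> i \<omega>) \<in> B})"
  have Jm: "J j \<in> events" if "j < n" for j
  proof -
    have [measurable]: "zero_outside ({..<n} - {j}) \<xi> \<in> measurable M (PiM UNIV (\<lambda>_. borel))"
      by (intro measurable_zero_outside[OF indep]) auto
    have [measurable]: "\<xi> j \<in> borel_measurable M" using that by simp
    show ?thesis unfolding J_def by simp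
  qed
  have Am: "A p \<in> events" if pP: "p \<in> P" for p
  proof -
    obtain j k where p: "p = (j, k)" "j < k" "k \<le> n" using pP unfolding P_def by auto
    have [measurable]: "zero_outside {j..<n} \<xi> \<in> measurable M (PiM UNIV (\<lambda>_. borel))"
      using p by (auto intro!: measurable_zero_outside[OF indep])
    have [measurable]: "(\<lambda>\<omega>. \<Sum>i<j. \<xi> i \<omega>) \<in> borel_measurable M" "(\<lambda>\<omega>. \<Sum>i<k. \<xi> i \<omega>) \<in> borel_measurable M"
      using p by simp_all
    show ?thesis unfolding A_def p by simp
  qed
  have J_le: "prob (J j) \<le> \<beta> + c * \<theta>" if "j < n" for j
    unfolding J_def using that step step' nonneg by (intro prob_single_jump_le) auto
  \<comment> \<open>Freezing the steps from \<open>j\<close> on turns the rise from \<open>j\<close>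
    to \<open>k\<close> into a constant shift; only the value of the walk at \<open>j\<close> stays
    random, and \<open>walk\<close> bounds it for every shift.\<close>
  have A_le: "prob (A (j, k)) \<le> d * prob {\<omega>\<in>space M. late_ascent (2 * a) n j k (zero_outside {j..<n} \<xi> \<omega>)}"
    if "(j, k) \<in> P" for j k
  proof -
    have jk: "j < k" "k \<le> n" using that by (auto simp: P_def)
    have ind: "indep_var (PiM UNIV (\<lambda>_. borel)) (zero_outside {j..<n} \<xi>) (PiM UNIV (\<lambda>_. borel)) (zero_outside {..<j} \<xi>)"
      using jk by (intro indep_var_zero_outside[OF indep]) auto
    have "prob {\<omega>\<in>space M. (\<lambda>u v. late_ascent (2 * a) n j k u \<and> a \<le> sum v {..<j} \<and> sum v {..<j} + sum u {..<k} \<in> B)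
          (zero_outside {j..<n} \<xi> \<omega>) (zero_outside {..<j} \<xi> \<omega>)} \<le>
        0 + d * prob {\<omega>\<in>space M. late_ascent (2 * a) n j k (zero_outside {j..<n} \<xi> \<omega>)}"
    proof (rule prob_indep_var_le[OF ind])
      fix u :: "nat \<Rightarrow> real"
      show "prob {\<omega>\<in>space M. late_ascent (2 * a) n j k u \<and> a \<le> sum (zero_outside {..<j} \<xi> \<omega>) {..<j} \<and>
          sum (zero_outside {..<j} \<xi> \<omega>) {..<j} + sum u {..<k} \<in> B}
        \<le> 0 + (if late_ascent (2 * a) n j k u then d else 0)"
        using walk[of j "sum u {..<k}"] jk by (auto simp: sum_zero_outside_first)
    next
      show "Measurable.pred (PiM UNIV (\<lambda>_. borel) \<Otimes>\<^sub>M PiM UNIV (\<lambda>_. borel))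
          (\<lambda>(u, v). late_ascent (2 * a) n j k u \<and> a \<le> sum v {..<j} \<and> sum v {..<j} + sum u {..<k} \<in> B)"
        unfolding partial_sum_def[symmetric] by measurable
    qed (use nonneg in measurable)
    then show ?thesis
      using jk by (simp add: A_def sum_zero_outside_first sum_zero_outside_last)
  qed
  have "{\<omega>\<in>space M. walk_max n (\<lambda>i. \<xi> i \<omega>) \<in> B} \<subseteq> (\<Union>j<n. J j) \<union> (\<Union>p\<in>P. A p)"
  proof
    fix \<omega> assume "\<omega> \<in> {\<omega>\<in>space M. walk_max n (\<lambda>i. \<xi> i \<omega>) \<in> B}"
    then have w: "\<omega> \<in> space M" "walk_max n (\<lambda>i. \<xi> i \<omega>) \<in> B" by auto
    have high: "0 < a" "4 * a \<le> walk_max n (\<lambda>i. \<xi> i \<omega>)"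
      using \<eta> a w B_high by auto
    show "\<omega> \<in> (\<Union>j<n. J j) \<union> (\<Union>p\<in>P. A p)"
    proof (rule walk_max_cases[OF high])
      fix j assume j: "j < n" "a \<le> \<xi> j \<omega>"
        "walk_max n (\<lambda>i. \<xi> i \<omega>) = \<xi> j \<omega> + walk_max_after j n ((\<lambda>i. \<xi> i \<omega>)(j := 0))"
      have "walk_max_after j n ((\<lambda>i. \<xi> i \<omega>)(j := 0)) = walk_max_after j n (zero_outside ({..<n} - {j}) \<xi> \<omega>)"
        by (intro walk_max_after_cong) (auto simp: zero_outside_def)
      then have "\<omega> \<in> J j" using w j by (simp add: J_def)
      with j show ?thesis by auto
    next
      fix j k assume jk: "j < k" "k \<le> n" "late_ascent (2 * a) n j k (\<lambda>i. \<xi> i \<omega>)"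
        "a \<le> (\<Sum>i<j. \<xi> i \<omega>)" "walk_max n (\<lambda>i. \<xi> i \<omega>) = (\<Sum>i<k. \<xi> i \<omega>)"
      then have "\<omega> \<in> A (j, k)" using w by (simp add: A_def late_ascent_zero_outside)
      moreover have "(j, k) \<in> P" using jk by (simp add: P_def)
      ultimately show ?thesis by blast
    qed
  qed
  then have "prob {\<omega>\<in>space M. walk_max n (\<lambda>i. \<xi> i \<omega>) \<in> B} \<le> prob ((\<Union>j<n. J j) \<union> (\<Union>p\<in>P. A p))"
    using Jm Am finP by (intro finite_measure_mono) auto
  also have "\<dots> \<le> prob (\<Union>j<n. J j) + prob (\<Union>p\<in>P. A p)"
    using Jm Am finP by (intro measure_Un_le) auto
  also have "\<dots> \<le> (\<Sum>j<n. prob (J j)) + (\<Sum>p\<in>P. prob (A p))"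
    using Jm Am finP by (intro add_mono measure_UNION_le) auto
  also have "\<dots> \<le> (\<Sum>j<n. \<beta> + c * \<theta>) +
      (\<Sum>(j, k)\<in>P. d * prob {\<omega>\<in>space M. late_ascent (2 * a) n j k (zero_outside {j..<n} \<xi> \<omega>)})"
    using J_le A_le by (intro add_mono sum_mono) auto
  also have "\<dots> = n * (\<beta> + c * \<theta>) +
      d * (\<Sum>(j, k)\<in>P. prob {\<omega>\<in>space M. late_ascent (2 * a) n j k (zero_outside {j..<n} \<xi> \<omega>)})"
    by (simp add: sum_distrib_left case_prod_unfold)
  also have "\<dots> \<le> n * (\<beta> + c * \<theta>) + d * (2 * \<theta>)"
    using sum_prob_late_ascent_le[OF \<theta>, of "2 * a"] a nonneg unfolding P_def
    by (intro add_left_mono mult_left_mono) auto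
  finally show ?thesis .
qed

text \<open>The event \<open>G j\<close> asks that the walk without step \<open>j\<close> stay
  within 3\<eta> and that the maximum after the jump lie in \<open>B\<close>. On it the walk is low
  up to \<open>j\<close> and high afterwards, so different \<open>j\<close> exclude each other and
  the maximum is attained after \<open>j\<close>. Conditioning on the other steps gives each
  \<open>G j\<close> probability at least \<alpha>(1 - \<theta>).\<close>

lemma prob_walk_max_ge:
  assumes B[measurable]: "B \<in> sets borel" and B_high: "B \<subseteq> {10 * \<eta>..}"
    and step: "\<And>j g. j < n \<Longrightarrow> \<bar>g\<bar> \<le> 3 * \<eta> \<Longrightarrow> \<alpha> \<le> prob {\<omega>\<in>space M. \<xi> j \<omega> + g \<in> B}"
    and nonneg: "0 \<le> \<alpha>"
  shows "n * (\<alpha> * (1 - \<theta>)) \<le> prob {\<omega>\<in>space M. walk_max n (\<lambda>i. \<xi> i \<omega>) \<in> B}"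
proof -
  let ?U = "\<lambda>j. zero_outside ({..<n} - {j}) \<xi>"
  define Q where "Q u \<longleftrightarrow> (\<forall>k\<le>n. \<bar>sum u {..<k}\<bar> \<le> 3 * \<eta>)" for u :: "nat \<Rightarrow> real"
  have [measurable]: "Measurable.pred (PiM UNIV (\<lambda>_. borel)) Q"
    unfolding Q_def partial_sum_def[symmetric] by measurable
  define G where "G j = {\<omega>\<in>space M. Q (?U j \<omega>) \<and> \<xi> j \<omega> + walk_max_after j n (?U j \<omega>) \<in> B}" for j
  have U[measurable]: "?U j \<in> measurable M (PiM UNIV (\<lambda>_. borel))" for j
    by (intro measurable_zero_outside[OF indep]) auto
  have Gm: "G j \<in> events" if "j < n" for j
  proof -
    have [measurable]: "\<xi> j \<in> borel_measurable M" using that by simp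
    show ?thesis unfolding G_def by simp
  qed
  have abs_after: "\<bar>walk_max_after j n u\<bar> \<le> 3 * \<eta>" if "Q u" "j < n" for u j
  proof -
    obtain k where "k \<le> n" "sum u {..<k} = walk_max_after j n u"
      using walk_max_after_attained[OF \<open>j < n\<close>] by metis
    then show ?thesis using \<open>Q u\<close> unfolding Q_def by auto
  qed
  have G_ge: "\<alpha> * (1 - \<theta>) \<le> prob (G j)" if j: "j < n" for j
  proof -
    have "1 - \<theta> \<le> 1 - prob {\<omega>\<in>space M. \<not> Q (?U j \<omega>)}"
      using prob_large_removed[OF j] by (simp add: Q_def)
    also have "\<dots> = prob (space M - {\<omega>\<in>space M. \<not> Q (?U j \<omega>)})"
      by (intro prob_compl[symmetric]) measurable
    also have "space M - {\<omega>\<in>space M. \<not> Q (?U j \<omega>)} = {\<omega>\<in>space M. Q (?U j \<omega>)}"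
      by auto
    finally have "\<alpha> * (1 - \<theta>) \<le> \<alpha> * prob {\<omega>\<in>space M. Q (?U j \<omega>)}"
      using nonneg by (intro mult_left_mono)
    also have "\<dots> \<le> prob {\<omega>\<in>space M. (\<lambda>u v. Q u \<and> v j + walk_max_after j n u \<in> B) (?U j \<omega>) (zero_outside {j} \<xi> \<omega>)}"
    proof (rule prob_indep_var_ge[OF indep_removed[OF j]])
      fix u assume "Q u"
      then show "\<alpha> \<le> prob {\<omega>\<in>space M. Q u \<and> zero_outside {j} \<xi> \<omega> j + walk_max_after j n u \<in> B}"
        using step[OF j abs_after[OF _ j]] by (simp add: zero_outside_def)
    qed (use nonneg in measurable)
    finally show ?thesis by (simp add: G_def zero_outside_def)
  qed
  have G_path: "(\<Sum>l<i. \<xi> l \<omega>) \<le> 3 * \<eta>" "j < i' \<Longrightarrow> i' \<le> n \<Longrightarrow> 4 * \<eta> \<le> (\<Sum>l<i'. \<xi> l \<omega>)"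
    if w: "\<omega> \<in> G j" and j: "j < n" and i: "i \<le> j" for \<omega> j i i'
  proof -
    have QU: "Q (?U j \<omega>)" using w by (simp add: G_def)
    show "(\<Sum>l<i. \<xi> l \<omega>) \<le> 3 * \<eta>"
    proof -
      have "\<bar>sum (?U j \<omega>) {..<i}\<bar> \<le> 3 * \<eta>" using QU i j unfolding Q_def by auto
      then show ?thesis using i j by (simp add: sum_zero_outside_remove)
    qed
    \<comment> \<open>The origin of \<open>10 * \<eta>\<close>: subtracting 3\<eta> for the other
      steps leaves a step of at least 7\<eta>, and another 3\<eta> leaves heights of at least
      4\<eta> after the jump, strictly above the 3\<eta> allowed before it.\<close>
    have "10 * \<eta> \<le> \<xi> j \<omega> + walk_max_after j n (?U j \<omega>)" using w B_high by (auto simp: G_def)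
    then have xi: "7 * \<eta> \<le> \<xi> j \<omega>" using abs_after[OF QU j] by linarith
    show "4 * \<eta> \<le> (\<Sum>l<i'. \<xi> l \<omega>)" if i': "j < i'" "i' \<le> n"
    proof -
      have "\<bar>sum (?U j \<omega>) {..<i'}\<bar> \<le> 3 * \<eta>" using QU i' unfolding Q_def by auto
      then show ?thesis using xi i' j by (simp add: sum_zero_outside_remove)
    qed
  qed
  have disj: "disjoint_family_on G {..<n}"
  proof -
    \<comment> \<open>At index \<open>Suc j\<close> the walk is already past jump \<open>j\<close>
      but not past jump \<open>j'\<close>, so it would be both at least 4\<eta> and at most
      3\<eta>.\<close>
    have "False" if "j < j'" "j' < n" "\<omega> \<in> G j" "\<omega> \<in> G j'" for j j' \<omega>
      using G_path(2)[of \<omega> j 0 "Suc j"] G_path(1)[of \<omega> j' "Suc j"] that \<eta> by force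
    then show ?thesis
      unfolding disjoint_family_on_def by (metis (no_types, lifting) disjoint_iff lessThan_iff linorder_neqE_nat)
  qed
  have "n * (\<alpha> * (1 - \<theta>)) = (\<Sum>j<n. \<alpha> * (1 - \<theta>))" by simp
  also have "\<dots> \<le> (\<Sum>j<n. prob (G j))" using G_ge by (intro sum_mono) auto
  also have "\<dots> = prob (\<Union>j<n. G j)"
    using disj Gm by (intro finite_measure_finite_Union[symmetric]) auto
  also have "\<dots> \<le> prob {\<omega>\<in>space M. walk_max n (\<lambda>i. \<xi> i \<omega>) \<in> B}"
  proof (intro finite_measure_mono subsetI)
    fix \<omega> assume "\<omega> \<in> (\<Union>j<n. G j)"
    then obtain j where j: "j < n" and w: "\<omega> \<in> G j" by auto
    have eq: "(\<Sum>l<i. \<xi> l \<omega>) = \<xi> j \<omega> + sum (?U j \<omega>) {..<i}" if "j < i" "i \<le> n" for i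
      using that j by (simp add: sum_zero_outside_remove)
    obtain k where k: "j < k" "k \<le> n" "sum (?U j \<omega>) {..<k} = walk_max_after j n (?U j \<omega>)"
      using walk_max_after_attained[OF j] by metis
    have "walk_max n (\<lambda>i. \<xi> i \<omega>) = (\<Sum>l<k. \<xi> l \<omega>)"
    proof (intro antisym walk_max_ge k)
      show "walk_max n (\<lambda>i. \<xi> i \<omega>) \<le> (\<Sum>l<k. \<xi> l \<omega>)"
        unfolding walk_max_le_iff
      proof (intro allI impI)
        fix i assume i: "i \<le> n"
        show "(\<Sum>l<i. \<xi> l \<omega>) \<le> (\<Sum>l<k. \<xi> l \<omega>)"
        proof (cases "j < i")
          case True
          then show ?thesis
            using eq[OF True i] eq[OF k(1,2)] k(3) walk_max_after_ge[OF True i, of "?U j \<omega>"] by simp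
        next
          case False
          then show ?thesis
            using G_path(1)[OF w j, of i] G_path(2)[OF w j, of 0 k] k \<eta> by auto
        qed
      qed
    qed
    also have "\<dots> = \<xi> j \<omega> + walk_max_after j n (?U j \<omega>)"
      using eq[OF k(1,2)] k(3) by simp
    finally show "\<omega> \<in> {\<omega>\<in>space M. walk_max n (\<lambda>i. \<xi> i \<omega>) \<in> B}"
      using w by (simp add: G_def)
  next
    show "{\<omega>\<in>space M. walk_max n (\<lambda>i. \<xi> i \<omega>) \<in> B} \<in> events"
      using rv_walk_max by measurable
  qed
  finally show ?thesis .
qed

end

end

subsection \<open>Comparison of densities and passage to the limit\<close>

text \<open>Test the integral inequality on the set where \<open>H < F\<close>, cut to [-k, k].
  There \<open>H\<close> is the minimum of the two functions, so \<open>K\<close> makes its integral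
  finite and a strict inequality can be contradicted. Bounding the minimum covers both uses, in
  which the bounded function is once \<open>H\<close> and once \<open>F\<close>.\<close>

lemma AE_le_from_set_nn_integral:
  fixes F H :: "real \<Rightarrow> ennreal" and S :: "real set" and K :: real
  assumes F[measurable]: "F \<in> borel_measurable borel" and H[measurable]: "H \<in> borel_measurable borel"
    and S[measurable]: "S \<in> sets borel"
    and le: "\<And>B. B \<in> sets borel \<Longrightarrow> bounded B \<Longrightarrow> B \<subseteq> S \<Longrightarrow> (\<integral>\<^sup>+x\<in>B. F x \<partial>lborel) \<le> (\<integral>\<^sup>+x\<in>B. H x \<partial>lborel)"
    and K: "\<And>x. x \<in> S \<Longrightarrow> min (F x) (H x) \<le> ennreal K"
  shows "AE x in lborel. x \<in> S \<longrightarrow> F x \<le> H x"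
proof -
  have "AE x in lborel. x \<in> S \<and> \<bar>x\<bar> \<le> real k \<longrightarrow> F x \<le> H x" for k :: nat
  proof -
    define B where "B = {x. x \<in> S \<and> \<bar>x\<bar> \<le> real k \<and> H x < F x}"
    have B[measurable]: "B \<in> sets borel" unfolding B_def by measurable
    have sub: "B \<subseteq> {- real k..real k}" by (auto simp: B_def)
    then have bdd: "bounded B" using bounded_closed_interval bounded_subset by blast
    have "(\<integral>\<^sup>+x\<in>B. H x \<partial>lborel) \<le> (\<integral>\<^sup>+x. ennreal K * indicator {- real k..real k} x \<partial>lborel)"
      using K sub by (intro nn_integral_mono) (force simp: B_def indicator_def min_def split: if_splits)
    also have "\<dots> < \<infinity>" by (simp add: nn_integral_cmult ennreal_mult_less_top)
    finally have fin: "(\<integral>\<^sup>+x\<in>B. H x \<partial>lborel) \<noteq> \<infinity>" by simp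
    have "AE x in lborel. F x * indicator B x \<le> H x * indicator B x"
    proof (rule ccontr)
      assume "\<not> ?thesis"
      moreover have "AE x in lborel. H x * indicator B x \<le> F x * indicator B x"
        by (auto simp: B_def indicator_def)
      ultimately have "(\<integral>\<^sup>+x\<in>B. H x \<partial>lborel) < (\<integral>\<^sup>+x\<in>B. F x \<partial>lborel)"
        using fin by (intro nn_integral_less) auto
      with le[OF B bdd] show False by (auto simp: B_def not_less[symmetric])
    qed
    then show ?thesis
    proof eventually_elim
      case (elim x)
      show ?case
      proof (rule ccontr)
        assume "\<not> ?case"
        then have "x \<in> B" "H x < F x" by (auto simp: B_def)
        then show False using elim by auto
      qed
    qed
  qed
  then have "AE x in lborel. \<forall>k::nat. x \<in> S \<and> \<bar>x\<bar> \<le> real k \<longrightarrow> F x \<le> H x"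
    unfolding AE_all_countable by blast
  then show ?thesis
    by eventually_elim (use real_arch_simple in blast)
qed

text \<open>Outer regularity: enlarging \<open>B\<close> to an open set can only increase the left
  side, and increases the right side by at most \<open>K\<close> times the excess measure.\<close>

lemma set_nn_integral_le_from_open:
  fixes F H :: "real \<Rightarrow> ennreal" and S :: "real set" and K :: real
  assumes F[measurable]: "F \<in> borel_measurable borel" and H[measurable]: "H \<in> borel_measurable borel"
    and S: "open S" and K: "\<And>x. x \<in> S \<Longrightarrow> H x \<le> ennreal K"
    and le: "\<And>U. open U \<Longrightarrow> bounded U \<Longrightarrow> U \<subseteq> S \<Longrightarrow> (\<integral>\<^sup>+x\<in>U. F x \<partial>lborel) \<le> (\<integral>\<^sup>+x\<in>U. H x \<partial>lborel)"
    and B: "B \<in> sets borel" "bounded B" "B \<subseteq> S"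
  shows "(\<integral>\<^sup>+x\<in>B. F x \<partial>lborel) \<le> (\<integral>\<^sup>+x\<in>B. H x \<partial>lborel)"
proof (rule ennreal_le_epsilon)
  fix e :: real assume e: "0 < e"
  note B(1)[measurable]
  \<comment> \<open>The summand 1 keeps the quotient meaningful for \<open>K = 0\<close> and still
    gives \<open>\<bar>K\<bar> * d \<le> e\<close>.\<close>
  define d where "d = e / (\<bar>K\<bar> + 1)"
  have d: "0 < d" "\<bar>K\<bar> * d \<le> e" using e by (auto simp: d_def field_simps)
  obtain T where T: "open T" "B \<subseteq> T" "T - B \<in> lmeasurable" "emeasure lebesgue (T - B) < ennreal d"
    using sets_lebesgue_outer_open[of B d] B d by auto
  obtain r where r: "B \<subseteq> ball 0 r" using bounded_subset_ballD[OF B(2)] by blast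
  define U where "U = T \<inter> S \<inter> ball 0 r"
  have U: "open U" "bounded U" "U \<subseteq> S" "B \<subseteq> U"
    using T S B r by (auto simp: U_def)
  have [measurable]: "T \<in> sets borel" "U \<in> sets borel" using T U by auto
  have small: "emeasure lborel (U - B) \<le> ennreal d"
  proof -
    have "emeasure lborel (U - B) \<le> emeasure lborel (T - B)"
      by (intro emeasure_mono) (auto simp: U_def)
    also have "\<dots> = emeasure lebesgue (T - B)" by simp
    finally show ?thesis using T(4) by simp
  qed
  have "(\<integral>\<^sup>+x\<in>B. F x \<partial>lborel) \<le> (\<integral>\<^sup>+x\<in>U. F x \<partial>lborel)"
    using U(4) by (intro nn_integral_mono) (auto simp: indicator_def)
  also have "\<dots> \<le> (\<integral>\<^sup>+x\<in>U. H x \<partial>lborel)" by (intro le U)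
  also have "\<dots> \<le> (\<integral>\<^sup>+x. H x * indicator B x + ennreal \<bar>K\<bar> * indicator (U - B) x \<partial>lborel)"
    using K U(3) order_trans[OF K ennreal_leI[OF abs_ge_self]]
    by (intro nn_integral_mono) (auto simp: indicator_def)
  also have "\<dots> = (\<integral>\<^sup>+x\<in>B. H x \<partial>lborel) + ennreal \<bar>K\<bar> * emeasure lborel (U - B)"
    by (simp add: nn_integral_add nn_integral_cmult)
  also have "\<dots> \<le> (\<integral>\<^sup>+x\<in>B. H x \<partial>lborel) + ennreal \<bar>K\<bar> * ennreal d"
    using small by (intro add_left_mono mult_left_mono) auto
  also have "\<dots> \<le> (\<integral>\<^sup>+x\<in>B. H x \<partial>lborel) + ennreal e"
    using d by (intro add_left_mono) (simp add: ennreal_mult[symmetric] ennreal_leI)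
  finally show "(\<integral>\<^sup>+x\<in>B. F x \<partial>lborel) \<le> (\<integral>\<^sup>+x\<in>B. H x \<partial>lborel) + ennreal e" .
qed

text \<open>The mirror image by inner regularity: shrinking \<open>B\<close> to a compact set loses
  at most \<open>K\<close> times the missing measure on the left, so now \<open>F\<close> is the
  function to be bounded.\<close>

lemma set_nn_integral_le_from_compact:
  fixes F H :: "real \<Rightarrow> ennreal" and S :: "real set" and K :: real
  assumes F[measurable]: "F \<in> borel_measurable borel" and H[measurable]: "H \<in> borel_measurable borel"
    and K: "\<And>x. x \<in> S \<Longrightarrow> F x \<le> ennreal K"
    and le: "\<And>T. compact T \<Longrightarrow> T \<subseteq> S \<Longrightarrow> (\<integral>\<^sup>+x\<in>T. F x \<partial>lborel) \<le> (\<integral>\<^sup>+x\<in>T. H x \<partial>lborel)"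
    and B: "B \<in> sets borel" "bounded B" "B \<subseteq> S"
  shows "(\<integral>\<^sup>+x\<in>B. F x \<partial>lborel) \<le> (\<integral>\<^sup>+x\<in>B. H x \<partial>lborel)"
proof (rule ennreal_le_epsilon)
  fix e :: real assume e: "0 < e"
  note B(1)[measurable]
  define d where "d = e / (\<bar>K\<bar> + 1)"
  have d: "0 < d" "\<bar>K\<bar> * d \<le> e" using e by (auto simp: d_def field_simps)
  obtain T where T: "closed T" "T \<subseteq> B" "B - T \<in> lmeasurable" "emeasure lebesgue (B - T) < ennreal d"
    using sets_lebesgue_inner_closed[of B d] B d by auto
  have "compact T" "T \<subseteq> S"
    using T B bounded_subset by (auto simp: compact_eq_bounded_closed)
  have [measurable]: "T \<in> sets borel" using T by auto
  have small: "emeasure lborel (B - T) \<le> ennreal d"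
    using T(4) by simp
  have "(\<integral>\<^sup>+x\<in>B. F x \<partial>lborel) \<le> (\<integral>\<^sup>+x. F x * indicator T x + ennreal \<bar>K\<bar> * indicator (B - T) x \<partial>lborel)"
    using K B(3) order_trans[OF K ennreal_leI[OF abs_ge_self]]
    by (intro nn_integral_mono) (auto simp: indicator_def)
  also have "\<dots> = (\<integral>\<^sup>+x\<in>T. F x \<partial>lborel) + ennreal \<bar>K\<bar> * emeasure lborel (B - T)"
    by (simp add: nn_integral_add nn_integral_cmult)
  also have "\<dots> \<le> (\<integral>\<^sup>+x\<in>T. H x \<partial>lborel) + ennreal \<bar>K\<bar> * ennreal d"
    using small le[OF \<open>compact T\<close> \<open>T \<subseteq> S\<close>] by (intro add_mono mult_left_mono) auto
  also have "\<dots> \<le> (\<integral>\<^sup>+x\<in>B. H x \<partial>lborel) + ennreal e"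
    using d T(2)
    by (intro add_mono nn_integral_mono) (auto simp: ennreal_mult[symmetric] ennreal_leI indicator_def)
  finally show "(\<integral>\<^sup>+x\<in>B. F x \<partial>lborel) \<le> (\<integral>\<^sup>+x\<in>B. H x \<partial>lborel) + ennreal e" .
qed

text \<open>The portmanteau inequality for pointwise limits: a limit in an open set forces the
  sequence into it eventually, so the event lies in the increasing union of the \<open>E m\<close>,
  each contained in an event of probability at most \<open>c\<close>.\<close>

lemma (in prob_space) prob_limit_open_le:
  fixes Z :: "nat \<Rightarrow> 'a \<Rightarrow> real"
  assumes [measurable]: "\<And>m. Z m \<in> borel_measurable M"
    and lim: "\<And>\<omega>. \<omega> \<in> space M \<Longrightarrow> (\<lambda>m. Z m \<omega>) \<longlonglongrightarrow> Z' \<omega>"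
    and U: "open U" and le: "\<And>m. prob {\<omega>\<in>space M. Z m \<omega> \<in> U} \<le> c"
  shows "prob {\<omega>\<in>space M. Z' \<omega> \<in> U} \<le> c"
proof -
  have [measurable]: "U \<in> sets borel" using U by simp
  define E where "E m = {\<omega>\<in>space M. \<forall>k\<ge>m. Z k \<omega> \<in> U}" for m
  have Em[measurable]: "E m \<in> events" for m unfolding E_def by measurable
  have "incseq E" by (force simp: incseq_def E_def)
  then have "(\<lambda>m. prob (E m)) \<longlonglongrightarrow> prob (\<Union>m. E m)"
    by (intro finite_Lim_measure_incseq) auto
  moreover have "prob (E m) \<le> c" for m
    by (rule order_trans[OF _ le[of m]]) (auto simp: E_def intro!: finite_measure_mono)
  ultimately have "prob (\<Union>m. E m) \<le> c" by (intro LIMSEQ_le_const2) auto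
  moreover have "prob {\<omega>\<in>space M. Z' \<omega> \<in> U} \<le> prob (\<Union>m. E m)"
  proof (intro finite_measure_mono subsetI)
    fix \<omega> assume w: "\<omega> \<in> {\<omega>\<in>space M. Z' \<omega> \<in> U}"
    then have "\<forall>\<^sub>F m in sequentially. Z m \<omega> \<in> U"
      using lim U by (auto dest: topological_tendstoD)
    with w show "\<omega> \<in> (\<Union>m. E m)" by (auto simp: E_def eventually_sequentially)
  qed auto
  ultimately show ?thesis by simp
qed

lemma (in prob_space) prob_limit_closed_ge:
  fixes Z :: "nat \<Rightarrow> 'a \<Rightarrow> real"
  assumes Z[measurable]: "\<And>m. Z m \<in> borel_measurable M" and Z'[measurable]: "Z' \<in> borel_measurable M"
    and lim: "\<And>\<omega>. \<omega> \<in> space M \<Longrightarrow> (\<lambda>m. Z m \<omega>) \<longlonglongrightarrow> Z' \<omega>"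
    and C: "closed C" and ge: "\<And>m. c \<le> prob {\<omega>\<in>space M. Z m \<omega> \<in> C}"
  shows "c \<le> prob {\<omega>\<in>space M. Z' \<omega> \<in> C}"
proof -
  have [measurable]: "C \<in> sets borel" using C by simp
  have compl: "prob {\<omega>\<in>space M. Y \<omega> \<in> - C} = 1 - prob {\<omega>\<in>space M. Y \<omega> \<in> C}"
    if [measurable]: "Y \<in> borel_measurable M" for Y
  proof -
    have "{\<omega>\<in>space M. Y \<omega> \<in> - C} = space M - {\<omega>\<in>space M. Y \<omega> \<in> C}" by auto
    then show ?thesis by (simp add: prob_compl)
  qed
  have "prob {\<omega>\<in>space M. Z' \<omega> \<in> - C} \<le> 1 - c"
    using ge compl[OF Z] C by (intro prob_limit_open_le[OF Z lim]) (auto simp: open_Compl)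
  then show ?thesis using compl[OF Z'] by simp
qed

section \<open>Cadlag paths and their suprema along grids\<close>

lemma cadlag_bounded:
  assumes x: "cadlag x" and t: "0 \<le> t"
  shows "bounded (x ` {0..t})"
proof -
  have bdd: "\<exists>C. \<forall>\<^sub>F u in F. \<bar>x u\<bar> \<le> C" if "(x \<longlongrightarrow> l) F" for F :: "real filter" and l
  proof -
    have "((\<lambda>u. \<bar>x u\<bar>) \<longlongrightarrow> \<bar>l\<bar>) F" using that by (rule tendsto_rabs)
    then have "\<forall>\<^sub>F u in F. \<bar>x u\<bar> < \<bar>l\<bar> + 1" by (rule order_tendstoD) simp
    then show ?thesis by (auto intro!: exI[of _ "\<bar>l\<bar> + 1"] elim: eventually_mono)
  qed
  have "\<exists>U C. open U \<and> s \<in> U \<and> (\<forall>u\<in>U \<inter> {0..t}. \<bar>x u\<bar> \<le> C)" if s: "s \<in> {0..t}" for s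
  proof -
    obtain C where "\<forall>\<^sub>F u in at_right s. \<bar>x u\<bar> \<le> C"
      using bdd x s unfolding cadlag_def by (meson atLeastAtMost_iff)
    then obtain b where b: "s < b" "\<And>u. s < u \<Longrightarrow> u < b \<Longrightarrow> \<bar>x u\<bar> \<le> C"
      by (auto simp: eventually_at_right_field)
    \<comment> \<open>At \<open>s = 0\<close> there is no left limit to use; the restriction
      \<open>0 \<le> u\<close> makes the left-hand bound vacuous there.\<close>
    obtain C' b' where b': "b' < s" "\<And>u. b' < u \<Longrightarrow> u < s \<Longrightarrow> 0 \<le> u \<Longrightarrow> \<bar>x u\<bar> \<le> C'"
    proof (cases "s = 0")
      case True
      then show ?thesis by (intro that[of "-1"]) auto
    next
      case False
      then have "0 < s" using s by simp
      then obtain l where "(x \<longlongrightarrow> l) (at_left s)"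
        using x unfolding cadlag_def by blast
      from bdd[OF this] show ?thesis
        using that by (auto simp: eventually_at_left_field)
    qed
    show ?thesis
    proof (intro exI conjI ballI)
      show "open {b'<..<b}" "s \<in> {b'<..<b}" using b b' by auto
      fix u assume "u \<in> {b'<..<b} \<inter> {0..t}"
      then show "\<bar>x u\<bar> \<le> max \<bar>x s\<bar> (max C C')"
        using b(2)[of u] b'(2)[of u] by (cases u s rule: linorder_cases) (auto simp: le_max_iff_disj)
    qed
  qed
  then obtain U C where U: "\<And>s. s \<in> {0..t} \<Longrightarrow> open (U s)" "\<And>s. s \<in> {0..t} \<Longrightarrow> s \<in> U s"
      "\<And>s u. s \<in> {0..t} \<Longrightarrow> u \<in> U s \<inter> {0..t} \<Longrightarrow> \<bar>x u\<bar> \<le> (C s :: real)"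
    by metis
  have "compact {0..t}" by simp
  then obtain D where D: "D \<subseteq> {0..t}" "finite D" "{0..t} \<subseteq> (\<Union>s\<in>D. U s)"
    by (rule compactE_image[of _ "{0..t}" U]) (use U in auto)
  have "\<bar>x u\<bar> \<le> Max (C ` D)" if "u \<in> {0..t}" for u
  proof -
    from that D(3) obtain s where s: "s \<in> D" "u \<in> U s" by blast
    then have "\<bar>x u\<bar> \<le> C s" using U(3)[of s u] D \<open>u \<in> {0..t}\<close> by auto
    also have "\<dots> \<le> Max (C ` D)" using D s by simp
    finally show ?thesis .
  qed
  then show ?thesis by (intro boundedI[of _ "Max (C ` D)"]) auto
qed

lemma cadlag_right_nhd:
  assumes "cadlag x" "0 \<le> s" "open U" "x s \<in> U"
  obtains d where "0 < d" "\<And>u. s \<le> u \<Longrightarrow> u < s + d \<Longrightarrow> x u \<in> U"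
proof -
  have "(x \<longlongrightarrow> x s) (at_right s)" using assms by (simp add: cadlag_def)
  then have "\<forall>\<^sub>F u in at_right s. x u \<in> U" using assms(3,4) by (rule topological_tendstoD)
  then obtain b where b: "s < b" "\<And>u. s < u \<Longrightarrow> u < b \<Longrightarrow> x u \<in> U"
    by (auto simp: eventually_at_right_field)
  show ?thesis
    using b assms(4) by (intro that[of "b - s"]) (auto simp: less_le)
qed

text \<open>A value above \<open>c\<close> persists on some interval [s, s + d) by right-continuity,
  and such an interval contains a grid point once the mesh is below \<open>d\<close>. Mesh
  \<open>t / real (Suc m)\<close> avoids a division by 0.\<close>

lemma cadlag_grid_max_tendsto:
  assumes x: "cadlag x" and t: "0 < t"
  shows "(\<lambda>m. Max ((\<lambda>k. x (real k * (t / real (Suc m)))) ` {..Suc m})) \<longlonglongrightarrow> (SUP s\<in>{0..t}. x s)"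
proof -
  have bdd: "bdd_above (x ` {0..t})"
    using cadlag_bounded[OF x] t by (intro bounded_imp_bdd_above) simp
  have grid: "real k * (t / real (Suc m)) \<in> {0..t}" if "k \<le> Suc m" for k m
  proof -
    have "real k * t \<le> real (Suc m) * t" using that t by (intro mult_right_mono) auto
    then show ?thesis using t by (auto simp: field_simps)
  qed
  have upper: "Max ((\<lambda>k. x (real k * (t / real (Suc m)))) ` {..Suc m}) \<le> (SUP s\<in>{0..t}. x s)" for m
    using grid bdd by (subst Max_le_iff) (auto intro!: cSUP_upper)
  show ?thesis
  proof (rule order_tendstoI)
    fix c assume "(SUP s\<in>{0..t}. x s) < c"
    then show "\<forall>\<^sub>F m in sequentially. Max ((\<lambda>k. x (real k * (t / real (Suc m)))) ` {..Suc m}) < c"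
      using upper by (intro always_eventually) (meson le_less_trans)
  next
    fix c assume "c < (SUP s\<in>{0..t}. x s)"
    then obtain s where s: "s \<in> {0..t}" "c < x s"
      using less_cSUP_iff[OF _ bdd] t by auto
    obtain d where d: "0 < d" "\<And>u. s \<le> u \<Longrightarrow> u < s + d \<Longrightarrow> x u \<in> {c<..}"
      using cadlag_right_nhd[OF x, of s "{c<..}"] s by auto
    have "(\<lambda>m. t / real (Suc m)) \<longlonglongrightarrow> 0"
      by (rule LIMSEQ_Suc[OF lim_const_over_n])
    then have "\<forall>\<^sub>F m in sequentially. t / real (Suc m) < d"
      using d(1) by (rule order_tendstoD)
    then show "\<forall>\<^sub>F m in sequentially. c < Max ((\<lambda>k. x (real k * (t / real (Suc m)))) ` {..Suc m})"
    proof eventually_elim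
      case (elim m)
      define h where "h = t / real (Suc m)"
      have h: "0 < h" "real (Suc m) * h = t" "h < d" using t elim by (auto simp: h_def)
      \<comment> \<open>The first grid point at or after \<open>s\<close>: rounding up stays on the
        side where the path is continuous, and \<open>s \<le> t\<close> keeps the index within the
        grid.\<close>
      define k where "k = nat \<lceil>s / h\<rceil>"
      have sh: "0 \<le> s / h" "s / h \<le> real (Suc m)" using s h by (auto simp: field_simps)
      have k: "real k = of_int \<lceil>s / h\<rceil>" using sh by (simp add: k_def)
      have "k \<le> Suc m" using sh(2) unfolding k_def
        by (metis ceiling_le_iff nat_le_iff of_int_of_nat_eq)
      moreover have "s \<le> real k * h" "real k * h < s + d"
      proof -
        have "s / h \<le> real k" "real k < s / h + 1" unfolding k by linarith+
        then have "s \<le> real k * h" "real k * h < s + h" using h(1) by (auto simp: field_simps)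
        then show "s \<le> real k * h" "real k * h < s + d" using h(3) by auto
      qed
      ultimately have "c < x (real k * h)" "x (real k * h) \<le> Max ((\<lambda>k. x (real k * h)) ` {..Suc m})"
        using d(2)[of "real k * h"] by auto
      then show ?case unfolding h_def by simp
    qed
  qed
qed

subsection \<open>Levy processes\<close>

lemma cadlag_diff_const:
  assumes "cadlag x"
  shows "cadlag (\<lambda>s. x s - c)"
  unfolding cadlag_def
proof safe
  fix t :: real
  assume "0 \<le> t"
  then show "((\<lambda>s. x s - c) \<longlongrightarrow> x t - c) (at_right t)"
    using assms by (intro tendsto_diff tendsto_const) (simp add: cadlag_def)
next
  fix t :: real
  assume "0 < t"
  then obtain l where "(x \<longlongrightarrow> l) (at_left t)" using assms by (auto simp: cadlag_def)
  then have "((\<lambda>s. x s - c) \<longlongrightarrow> l - c) (at_left t)" by (intro tendsto_diff tendsto_const)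
  then show "\<exists>l. ((\<lambda>s. x s - c) \<longlongrightarrow> l) (at_left t)" ..
qed

context levy_process
begin

lemma indep_vars_grid:
  assumes "0 \<le> h"
  shows "indep_vars (\<lambda>_. borel) (\<lambda>i \<omega>. X (real (Suc i) * h) \<omega> - X (real i * h) \<omega>) {..<n}"
  using assms by (intro indep_increments[of "\<lambda>i. real i * h"]) (auto intro: mult_right_mono)

text \<open>The walk of increments sees \<open>X - X 0\<close>, not \<open>X\<close>; the two agree
  only almost surely, so path arguments are made for the difference.\<close>

lemma sum_grid_increments:
  "(\<Sum>i<k. X (real (Suc i) * h) \<omega> - X (real i * h) \<omega>) = X (real k * h) \<omega> - X 0 \<omega>"
  using sum_lessThan_telescope[of "\<lambda>i. X (real i * h) \<omega>" k] by simp

lemma prob_increment: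
  assumes s: "0 \<le> s" and u: "0 \<le> u" and B[measurable]: "B \<in> sets borel"
  shows "prob {\<omega>\<in>space M. X (s + u) \<omega> - X s \<omega> \<in> B} = measure (distr M borel (X u)) B"
proof -
  have [measurable]: "X s \<in> borel_measurable M" "X (s + u) \<in> borel_measurable M"
    using s u by (auto intro: measurable_X)
  have "measure (distr M borel (\<lambda>\<omega>. X (s + u) \<omega> - X s \<omega>)) B = prob {\<omega>\<in>space M. X (s + u) \<omega> - X s \<omega> \<in> B}"
    by (subst measure_distr) (auto intro!: arg_cong[where f=prob])
  then show ?thesis using stationary_increments[OF s u] by simp
qed

text \<open>One bound has to serve all grids and all small \<open>t\<close>. Every grid event lies
  in \<open>D r\<close>, a countable union over rational times in (0, 1/(r+1)); the sets
  \<open>D r\<close> decrease to the empty set by right-continuity at 0, so their probabilities tend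
  to 0.\<close>

lemma small_time_oscillation:
  assumes \<eta>: "0 < \<eta>" and \<theta>: "0 < \<theta>"
  shows "\<exists>b>0. \<forall>t m. 0 < t \<longrightarrow> t < b \<longrightarrow>
    prob {\<omega>\<in>space M. \<exists>k\<le>Suc m. \<eta> < \<bar>X (real k * (t / real (Suc m))) \<omega> - X 0 \<omega>\<bar>} \<le> \<theta>"
proof -
  define D where "D r = (\<Union>q\<in>\<rat> \<inter> {0<..<1 / real (Suc r)}. {\<omega>\<in>space M. \<eta> < \<bar>X q \<omega> - X 0 \<omega>\<bar>})" for r
  have ev: "{\<omega>\<in>space M. \<eta> < \<bar>X q \<omega> - X 0 \<omega>\<bar>} \<in> events" if "0 \<le> q" for q
  proof -
    have [measurable]: "X q \<in> borel_measurable M" "X 0 \<in> borel_measurable M"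
      using that by (auto intro: measurable_X)
    show ?thesis by measurable
  qed
  have Dm: "D r \<in> events" for r
    unfolding D_def by (intro sets.countable_UN'' ev countable_Int1 countable_rat) auto
  have nhd: "\<exists>d>0. \<forall>u. s \<le> u \<longrightarrow> u < s + d \<longrightarrow> X u \<omega> - X 0 \<omega> \<in> U"
    if "\<omega> \<in> space M" "0 \<le> s" "open U" "X s \<omega> - X 0 \<omega> \<in> U" for \<omega> s U
  proof -
    have "cadlag (\<lambda>s. X s \<omega> - X 0 \<omega>)" using that by (intro cadlag_diff_const cadlag_paths)
    from cadlag_right_nhd[OF this that(2-4)] show ?thesis by metis
  qed
  have "decseq D"
  proof (rule decseq_SucI)
    fix r
    have "1 / real (Suc (Suc r)) \<le> 1 / real (Suc r)" by (intro divide_left_mono) auto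
    then show "D (Suc r) \<subseteq> D r" unfolding D_def by (intro UN_mono) auto
  qed
  then have "(\<lambda>r. prob (D r)) \<longlonglongrightarrow> prob (\<Inter>r. D r)"
    using Dm by (intro finite_Lim_measure_decseq) auto
  moreover have "(\<Inter>r. D r) = {}"
  proof (rule equals0I)
    fix \<omega> assume w: "\<omega> \<in> (\<Inter>r. D r)"
    then have "\<omega> \<in> space M" by (auto simp: D_def)
    have "open {y::real. \<bar>y\<bar> < \<eta>}" by (intro open_Collect_less continuous_intros)
    then obtain d where d: "0 < d" "\<And>u. 0 \<le> u \<Longrightarrow> u < d \<Longrightarrow> \<bar>X u \<omega> - X 0 \<omega>\<bar> < \<eta>"
      using nhd[of \<omega> 0 "{y. \<bar>y\<bar> < \<eta>}"] \<open>\<omega> \<in> space M\<close> \<eta> by auto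
    obtain r where r: "1 / real (Suc r) < d" using d(1) nat_approx_posE by blast
    from w have "\<omega> \<in> D r" by blast
    then obtain q where "0 < q" "q < 1 / real (Suc r)" "\<eta> < \<bar>X q \<omega> - X 0 \<omega>\<bar>"
      unfolding D_def by auto
    with d(2)[of q] r show False by auto
  qed
  ultimately have "\<forall>\<^sub>F r in sequentially. prob (D r) < \<theta>"
    using \<theta> by (intro order_tendstoD) simp_all
  then obtain r where r: "prob (D r) < \<theta>" by (auto simp: eventually_sequentially)
  show ?thesis
  proof (intro exI[of _ "1 / real (Suc r)"] conjI allI impI)
    fix t :: real and m assume t: "0 < t" "t < 1 / real (Suc r)"
    have "prob {\<omega>\<in>space M. \<exists>k\<le>Suc m. \<eta> < \<bar>X (real k * (t / real (Suc m))) \<omega> - X 0 \<omega>\<bar>} \<le> prob (D r)"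
    proof (intro finite_measure_mono subsetI Dm)
      fix \<omega> assume "\<omega> \<in> {\<omega>\<in>space M. \<exists>k\<le>Suc m. \<eta> < \<bar>X (real k * (t / real (Suc m))) \<omega> - X 0 \<omega>\<bar>}"
      then obtain k where w: "\<omega> \<in> space M" and k: "k \<le> Suc m" "\<eta> < \<bar>X (real k * (t / real (Suc m))) \<omega> - X 0 \<omega>\<bar>"
        by auto
      define s where "s = real k * (t / real (Suc m))"
      have "real k * t \<le> real (Suc m) * t" using k t by (intro mult_right_mono) auto
      then have s: "0 \<le> s" "s \<le> t" using t by (auto simp: s_def field_simps)
      have "open {y::real. \<eta> < \<bar>y\<bar>}" by (intro open_Collect_less continuous_intros)
      then obtain d where d: "0 < d" "\<And>u. s \<le> u \<Longrightarrow> u < s + d \<Longrightarrow> \<eta> < \<bar>X u \<omega> - X 0 \<omega>\<bar>"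
        using nhd[OF w s(1), of "{y. \<eta> < \<bar>y\<bar>}"] k(2) unfolding s_def[symmetric] by auto
      \<comment> \<open>The strict inequality at the grid time \<open>s\<close> persists immediately
        to its right, so a rational time there, still below \<open>1 / real (Suc r)\<close>,
        witnesses it.\<close>
      obtain q where q: "q \<in> \<rat>" "s < q" "q < min (s + d) (1 / real (Suc r))"
        using Rats_dense_in_real[of s "min (s + d) (1 / real (Suc r))"] s t d(1) by auto
      then have "q \<in> \<rat> \<inter> {0<..<1 / real (Suc r)}" "\<eta> < \<bar>X q \<omega> - X 0 \<omega>\<bar>"
        using s d(2)[of q] by auto
      then show "\<omega> \<in> D r" unfolding D_def using w by blast
    qed
    with r show "prob {\<omega>\<in>space M. \<exists>k\<le>Suc m. \<eta> < \<bar>X (real k * (t / real (Suc m))) \<omega> - X 0 \<omega>\<bar>} \<le> \<theta>"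
      by simp
  qed simp
qed

lemma walk_max_grid_tendsto:
  assumes t: "0 < t" and w: "\<omega> \<in> space M"
  shows "(\<lambda>m. walk_max (Suc m) (\<lambda>i. X (real (Suc i) * (t / real (Suc m))) \<omega> - X (real i * (t / real (Suc m))) \<omega>))
    \<longlonglongrightarrow> running_sup (\<lambda>s \<omega>. X s \<omega> - X 0 \<omega>) t \<omega>"
  unfolding walk_max_def sum_grid_increments running_sup_def
  using w by (intro cadlag_grid_max_tendsto[OF _ t] cadlag_diff_const cadlag_paths)

lemma measurable_running_sup:
  assumes t: "0 < t"
  shows "running_sup X t \<in> borel_measurable M"
proof (rule borel_measurable_LIMSEQ_real)
  show "(\<lambda>m. Max ((\<lambda>k. X (real k * (t / real (Suc m))) \<omega>) ` {..Suc m})) \<longlonglongrightarrow> running_sup X t \<omega>"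
    if "\<omega> \<in> space M" for \<omega>
    unfolding running_sup_def using that by (intro cadlag_grid_max_tendsto[OF _ t] cadlag_paths)
  show "(\<lambda>\<omega>. Max ((\<lambda>k. X (real k * (t / real (Suc m))) \<omega>) ` {..Suc m})) \<in> borel_measurable M" for m
    using t by (intro borel_measurable_Max measurable_X) auto
qed

lemma measurable_walk_max_grid:
  assumes t: "0 < t"
  shows "(\<lambda>\<omega>. walk_max (Suc m) (\<lambda>i. X (real (Suc i) * (t / real (Suc m))) \<omega> - X (real i * (t / real (Suc m))) \<omega>))
    \<in> borel_measurable M"
  unfolding walk_max_def sum_grid_increments
  using t by (intro borel_measurable_Max borel_measurable_diff measurable_X) auto

lemma emeasure_distr_running_sup:
  assumes t: "0 < t" and B[measurable]: "B \<in> sets borel"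
  shows "emeasure (distr M borel (running_sup X t)) B =
    ennreal (prob {\<omega>\<in>space M. running_sup (\<lambda>s \<omega>. X s \<omega> - X 0 \<omega>) t \<omega> \<in> B})"
proof -
  have [measurable]: "running_sup (\<lambda>s \<omega>. X s \<omega> - X 0 \<omega>) t \<in> borel_measurable M"
    by (rule borel_measurable_LIMSEQ_real[OF walk_max_grid_tendsto[OF t] measurable_walk_max_grid[OF t]])
  note measurable_running_sup[OF t, measurable]
  have "emeasure (distr M borel (running_sup X t)) B = emeasure M {\<omega>\<in>space M. running_sup X t \<omega> \<in> B}"
    by (subst emeasure_distr) (auto intro!: arg_cong[where f="emeasure M"])
  also have "\<dots> = emeasure M {\<omega>\<in>space M. running_sup (\<lambda>s \<omega>. X s \<omega> - X 0 \<omega>) t \<omega> \<in> B}"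
  proof (rule emeasure_eq_AE)
    show "AE \<omega> in M. \<omega> \<in> {\<omega>\<in>space M. running_sup X t \<omega> \<in> B} \<longleftrightarrow>
        \<omega> \<in> {\<omega>\<in>space M. running_sup (\<lambda>s \<omega>. X s \<omega> - X 0 \<omega>) t \<omega> \<in> B}"
      using start by eventually_elim (simp add: running_sup_def)
  qed measurable
  finally show ?thesis by (simp add: emeasure_eq_measure)
qed

section \<open>Grid walks at a fixed time: bounds uniform in the mesh\<close>

context
  fixes \<nu> :: "real \<Rightarrow> real" and t a \<eta> \<epsilon> \<theta> C :: real
  assumes \<nu>[measurable]: "\<nu> \<in> borel_measurable borel" and \<nu>_nonneg: "\<And>x. 0 \<le> \<nu> x"
    and \<nu>_le: "\<And>x. a \<le> x \<Longrightarrow> \<nu> x \<le> C"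
    and osc: "\<And>x y. a \<le> x \<Longrightarrow> a \<le> y \<Longrightarrow> \<bar>x - y\<bar> \<le> 3 * \<eta> \<Longrightarrow> \<bar>\<nu> x - \<nu> y\<bar> \<le> \<epsilon>"
    and t: "0 < t" and \<eta>: "0 < \<eta>" "10 * \<eta> \<le> a" and \<epsilon>: "0 < \<epsilon>"
    and law_le: "\<And>s B. 0 < s \<Longrightarrow> s \<le> t \<Longrightarrow> B \<in> sets borel \<Longrightarrow> B \<subseteq> {a..} \<Longrightarrow>
      emeasure (distr M borel (X s)) B \<le> (\<integral>\<^sup>+x\<in>B. ennreal (s * (\<nu> x + \<epsilon>)) \<partial>lborel)"
    and law_ge: "\<And>s B. 0 < s \<Longrightarrow> s \<le> t \<Longrightarrow> B \<in> sets borel \<Longrightarrow> B \<subseteq> {a..} \<Longrightarrow>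
      (\<integral>\<^sup>+x\<in>B. ennreal (s * (\<nu> x - \<epsilon>)) \<partial>lborel) \<le> emeasure (distr M borel (X s)) B"
    and small: "\<And>m. prob {\<omega>\<in>space M. \<exists>k\<le>Suc m. \<eta> < \<bar>X (real k * (t / real (Suc m))) \<omega> - X 0 \<omega>\<bar>} \<le> \<theta>"
    and \<theta>: "\<theta> \<le> 1 / 2" "3 * \<theta> * (C + \<epsilon>) \<le> \<epsilon>"
begin

private lemma C_nonneg: "0 \<le> C"
  using \<nu>_nonneg[of a] \<nu>_le[of a] by simp

private lemma \<theta>_nonneg: "0 \<le> \<theta>"
  using small[of 0] measure_nonneg order_trans by blast

private lemma nn_integral_shift:
  fixes F :: "real \<Rightarrow> ennreal"
  assumes [measurable]: "F \<in> borel_measurable borel"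
  shows "(\<integral>\<^sup>+v. F (v + g) \<partial>lborel) = (\<integral>\<^sup>+y. F y \<partial>lborel)"
  using nn_integral_real_affine[of F 1 g] by (simp add: add.commute)

text \<open>One \<open>\<epsilon>\<close> compares the law of \<open>X s\<close> with
  \<open>s * \<nu>\<close>; the second pays for the oscillation of \<open>\<nu>\<close> under a
  shift of at most 3\<eta>.\<close>

private lemma law_shift_le:
  assumes s: "0 < s" "s \<le> t" and B[measurable]: "B \<in> sets borel" and high: "B \<subseteq> {4 * a..}" and g: "\<bar>g\<bar> \<le> 3 * \<eta>"
  shows "emeasure (distr M borel (X s)) {v. a \<le> v \<and> v + g \<in> B} \<le> (\<integral>\<^sup>+y\<in>B. ennreal (s * (\<nu> y + 2 * \<epsilon>)) \<partial>lborel)"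
proof -
  have "emeasure (distr M borel (X s)) {v. a \<le> v \<and> v + g \<in> B}
      \<le> (\<integral>\<^sup>+v\<in>{v. a \<le> v \<and> v + g \<in> B}. ennreal (s * (\<nu> v + \<epsilon>)) \<partial>lborel)"
    by (rule law_le[OF s]) auto
  also have "\<dots> \<le> (\<integral>\<^sup>+v. ennreal (s * (\<nu> (v + g) + 2 * \<epsilon>)) * indicator B (v + g) \<partial>lborel)"
  proof (intro nn_integral_mono)
    fix v
    show "ennreal (s * (\<nu> v + \<epsilon>)) * indicator {v. a \<le> v \<and> v + g \<in> B} v
      \<le> ennreal (s * (\<nu> (v + g) + 2 * \<epsilon>)) * indicator B (v + g)"
    proof (cases "a \<le> v \<and> v + g \<in> B")
      case True
      then have "a \<le> v" "a \<le> v + g" using high \<eta> by auto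
      then have "\<nu> v + \<epsilon> \<le> \<nu> (v + g) + 2 * \<epsilon>" using osc[of v "v + g"] g by simp
      then show ?thesis using True s by (auto intro!: ennreal_leI mult_left_mono)
    qed auto
  qed
  also have "\<dots> = (\<integral>\<^sup>+y\<in>B. ennreal (s * (\<nu> y + 2 * \<epsilon>)) \<partial>lborel)"
    by (rule nn_integral_shift) measurable
  finally show ?thesis .
qed

text \<open>For an arbitrary shift the values of \<open>\<nu>\<close> at \<open>v\<close> and
  \<open>v + g\<close> are unrelated, so \<open>\<nu>\<close> is replaced by its bound
  \<open>C\<close> on [a, \<infinity>), and translation invariance of Lebesgue measure removes
  \<open>g\<close>.\<close>

private lemma law_shift_le':
  assumes s: "0 < s" "s \<le> t" and B[measurable]: "B \<in> sets borel"
  shows "emeasure (distr M borel (X s)) {v. a \<le> v \<and> v + g \<in> B} \<le> ennreal (s * (C + \<epsilon>)) * emeasure lborel B"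
proof -
  have "emeasure (distr M borel (X s)) {v. a \<le> v \<and> v + g \<in> B}
      \<le> (\<integral>\<^sup>+v\<in>{v. a \<le> v \<and> v + g \<in> B}. ennreal (s * (\<nu> v + \<epsilon>)) \<partial>lborel)"
    by (rule law_le[OF s]) auto
  also have "\<dots> \<le> (\<integral>\<^sup>+v. ennreal (s * (C + \<epsilon>)) * indicator B (v + g) \<partial>lborel)"
    using s \<nu>_le by (intro nn_integral_mono) (auto simp: indicator_def intro!: ennreal_leI mult_left_mono)
  also have "\<dots> = (\<integral>\<^sup>+y. ennreal (s * (C + \<epsilon>)) * indicator B y \<partial>lborel)"
    by (rule nn_integral_shift) measurable
  also have "\<dots> = ennreal (s * (C + \<epsilon>)) * emeasure lborel B"
    by (simp add: nn_integral_cmult)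
  finally show ?thesis .
qed

private lemma law_shift_ge:
  assumes s: "0 < s" "s \<le> t" and B[measurable]: "B \<in> sets borel" and high: "B \<subseteq> {4 * a..}" and g: "\<bar>g\<bar> \<le> 3 * \<eta>"
  shows "(\<integral>\<^sup>+y\<in>B. ennreal (s * (\<nu> y - 2 * \<epsilon>)) \<partial>lborel) \<le> emeasure (distr M borel (X s)) {v. v + g \<in> B}"
proof -
  \<comment> \<open>Since \<open>B\<close> starts at \<open>4 * a\<close> and |g| is at most
    3\<eta>, hence at most 3a/10, the unshifted point also lies above \<open>a\<close>.\<close>
  have sub: "a \<le> v" "a \<le> v + g" if "v + g \<in> B" for v
    using that high g \<eta> by force+
  have "(\<integral>\<^sup>+y\<in>B. ennreal (s * (\<nu> y - 2 * \<epsilon>)) \<partial>lborel) =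
      (\<integral>\<^sup>+v. ennreal (s * (\<nu> (v + g) - 2 * \<epsilon>)) * indicator B (v + g) \<partial>lborel)"
    by (rule nn_integral_shift[symmetric]) measurable
  also have "\<dots> \<le> (\<integral>\<^sup>+v\<in>{v. v + g \<in> B}. ennreal (s * (\<nu> v - \<epsilon>)) \<partial>lborel)"
  proof (intro nn_integral_mono)
    fix v
    show "ennreal (s * (\<nu> (v + g) - 2 * \<epsilon>)) * indicator B (v + g)
      \<le> ennreal (s * (\<nu> v - \<epsilon>)) * indicator {v. v + g \<in> B} v"
    proof (cases "v + g \<in> B")
      case True
      then have "\<nu> (v + g) - 2 * \<epsilon> \<le> \<nu> v - \<epsilon>" using osc[of v "v + g"] sub g by simp
      then show ?thesis using True s by (auto intro!: ennreal_leI mult_left_mono)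
    qed auto
  qed
  also have "\<dots> \<le> emeasure (distr M borel (X s)) {v. v + g \<in> B}"
    using sub by (intro law_ge[OF s]) auto
  finally show ?thesis .
qed

private lemma emeasure_distr_eq_prob:
  assumes "0 \<le> s" "0 \<le> u" "B \<in> sets borel"
  shows "emeasure (distr M borel (X u)) B = ennreal (prob {\<omega>\<in>space M. X (s + u) \<omega> - X s \<omega> \<in> B})"
proof -
  interpret D: prob_space "distr M borel (X u)"
    using assms by (intro prob_space_distr measurable_X)
  show ?thesis using prob_increment[OF assms] by (simp add: D.emeasure_eq_measure)
qed

private lemma set_nn_integral_bounded:
  fixes F :: "real \<Rightarrow> real"
  assumes B[measurable]: "B \<in> sets borel" and fin: "emeasure lborel B \<noteq> \<infinity>" and high: "B \<subseteq> {a..}"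
    and F: "\<And>x. a \<le> x \<Longrightarrow> F x \<le> K"
  shows "(\<integral>\<^sup>+y\<in>B. ennreal (F y) \<partial>lborel) \<noteq> \<infinity>"
proof -
  have "(\<integral>\<^sup>+y\<in>B. ennreal (F y) \<partial>lborel) \<le> (\<integral>\<^sup>+y. ennreal K * indicator B y \<partial>lborel)"
    using F high by (intro nn_integral_mono) (auto simp: indicator_def intro!: ennreal_leI)
  also have "\<dots> = ennreal K * emeasure lborel B" by (simp add: nn_integral_cmult)
  also have "\<dots> < \<infinity>" using fin by (simp add: ennreal_mult_less_top less_top)
  finally show ?thesis by simp
qed

private lemma grid_time:
  assumes "k \<le> Suc m"
  shows "0 \<le> real k * (t / real (Suc m))" "real k * (t / real (Suc m)) \<le> t"
proof -
  have "real k * t \<le> real (Suc m) * t" using assms t by (intro mult_right_mono) auto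
  then show "0 \<le> real k * (t / real (Suc m))" "real k * (t / real (Suc m)) \<le> t"
    using t by (auto simp: field_simps)
qed

private lemma grid_step: "real (Suc j) * h = real j * h + h" for h :: real
  by (simp add: algebra_simps)

text \<open>With \<open>n * h = t\<close> the single jumps give the main term \<open>t * J\<close>,
  whose integrand carries 2\<epsilon>, and an error \<theta> t (C + \<epsilon>) |B|; the ascents add
  2\<theta> t (C + \<epsilon>) |B|. The choice of \<open>\<theta>\<close> makes the total error at
  most \<epsilon> t |B|, the third \<open>\<epsilon>\<close>. The mesh has cancelled.\<close>

lemma prob_walk_max_grid_le:
  assumes B[measurable]: "B \<in> sets borel" and fin: "emeasure lborel B \<noteq> \<infinity>" and high: "B \<subseteq> {4 * a..}"
  shows "ennreal (prob {\<omega>\<in>space M.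
      walk_max (Suc m) (\<lambda>i. X (real (Suc i) * (t / real (Suc m))) \<omega> - X (real i * (t / real (Suc m))) \<omega>) \<in> B})
    \<le> (\<integral>\<^sup>+y\<in>B. ennreal (t * (\<nu> y + 3 * \<epsilon>)) \<partial>lborel)"
proof -
  define n h where "n = Suc m" and "h = t / real n"
  have h: "0 < h" "h \<le> t" "real n * h = t"
    using t grid_time[of 1 m] by (auto simp: h_def n_def)
  define L where "L = measure lborel B"
  have L: "emeasure lborel B = ennreal L" "0 \<le> L" using fin by (auto simp: L_def emeasure_eq_ennreal_measure)
  define J where "J = enn2real (\<integral>\<^sup>+y\<in>B. ennreal (\<nu> y + 2 * \<epsilon>) \<partial>lborel)"
  have hiB: "B \<subseteq> {a..}" using high \<eta> by force
  have J: "(\<integral>\<^sup>+y\<in>B. ennreal (\<nu> y + 2 * \<epsilon>) \<partial>lborel) = ennreal J" "0 \<le> J"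
    using set_nn_integral_bounded[OF B fin hiB, of "\<lambda>y. \<nu> y + 2 * \<epsilon>" "C + 2 * \<epsilon>"] \<nu>_le
    by (auto simp: J_def less_top)
  have Jm: "(\<integral>\<^sup>+y\<in>B. ennreal (s * (\<nu> y + 2 * \<epsilon>)) \<partial>lborel) = ennreal (s * J)" if "0 < s" for s
  proof -
    have "(\<integral>\<^sup>+y\<in>B. ennreal (s * (\<nu> y + 2 * \<epsilon>)) \<partial>lborel) =
        (\<integral>\<^sup>+y. ennreal s * (ennreal (\<nu> y + 2 * \<epsilon>) * indicator B y) \<partial>lborel)"
      using that \<nu>_nonneg \<epsilon> by (intro nn_integral_cong) (simp add: ennreal_mult mult.assoc)
    also have "\<dots> = ennreal (s * J)"
      using that J by (simp add: nn_integral_cmult ennreal_mult)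
    finally show ?thesis .
  qed
  define \<xi> where "\<xi> i \<omega> = X (real (Suc i) * h) \<omega> - X (real i * h) \<omega>" for i \<omega>
  have indep: "indep_vars (\<lambda>_. borel) \<xi> {..<n}"
    unfolding \<xi>_def using h by (intro indep_vars_grid) auto
  have sum: "(\<Sum>i<k. \<xi> i \<omega>) = X (real k * h) \<omega> - X 0 \<omega>" for k \<omega>
    unfolding \<xi>_def by (rule sum_grid_increments)
  have step: "ennreal (prob {\<omega>\<in>space M. a \<le> \<xi> j \<omega> \<and> \<xi> j \<omega> + g \<in> B}) =
      emeasure (distr M borel (X h)) {v. a \<le> v \<and> v + g \<in> B}" for j g
    using emeasure_distr_eq_prob[of "real j * h" h "{v. a \<le> v \<and> v + g \<in> B}"] h
    unfolding \<xi>_def grid_step by simp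
  have "prob {\<omega>\<in>space M. walk_max n (\<lambda>i. \<xi> i \<omega>) \<in> B}
      \<le> n * (h * J + h * (C + \<epsilon>) * L * \<theta>) + t * (C + \<epsilon>) * L * (2 * \<theta>)"
  proof (rule prob_walk_max_le[OF indep \<eta>(1)])
    show "prob {\<omega>\<in>space M. \<exists>k\<le>n. \<eta> < \<bar>\<Sum>i<k. \<xi> i \<omega>\<bar>} \<le> \<theta>"
      using small[of m] unfolding sum h_def n_def .
    show "prob {\<omega>\<in>space M. a \<le> \<xi> j \<omega> \<and> \<xi> j \<omega> + g \<in> B} \<le> h * J" if "\<bar>g\<bar> \<le> 3 * \<eta>" for j g
      using law_shift_le[OF h(1,2) B high that] h J unfolding step[symmetric, of g j] Jm[OF h(1)]
      by simp
    show "prob {\<omega>\<in>space M. a \<le> \<xi> j \<omega> \<and> \<xi> j \<omega> + g \<in> B} \<le> h * (C + \<epsilon>) * L" for j g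
      using law_shift_le'[OF h(1,2) B, of g] h L C_nonneg \<epsilon> unfolding step[symmetric, of g j] L(1)
      by (simp add: ennreal_mult[symmetric])
    show "prob {\<omega>\<in>space M. a \<le> (\<Sum>i<j. \<xi> i \<omega>) \<and> (\<Sum>i<j. \<xi> i \<omega>) + g \<in> B} \<le> t * (C + \<epsilon>) * L"
      if "j < n" for j g
    \<comment> \<open>The law comparison covers positive times only. At \<open>j = 0\<close> the
      empty sum is 0, which is below \<open>a\<close>, so the event is empty.\<close>
    proof (cases "j = 0")
      case True
      have "\<not> a \<le> 0" using \<eta> by simp
      then show ?thesis using True t L C_nonneg \<epsilon> by simp
    next
      case False
      define s where "s = real j * h"
      have s: "0 < s" "s \<le> t" using False h that grid_time[of j m] by (auto simp: s_def h_def n_def)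
      have "ennreal (prob {\<omega>\<in>space M. a \<le> (\<Sum>i<j. \<xi> i \<omega>) \<and> (\<Sum>i<j. \<xi> i \<omega>) + g \<in> B}) =
          emeasure (distr M borel (X s)) {v. a \<le> v \<and> v + g \<in> B}"
        using emeasure_distr_eq_prob[of 0 s "{v. a \<le> v \<and> v + g \<in> B}"] s
        unfolding sum s_def by simp
      also have "\<dots> \<le> ennreal (s * (C + \<epsilon>)) * emeasure lborel B" by (rule law_shift_le'[OF s B])
      also have "\<dots> \<le> ennreal (t * (C + \<epsilon>)) * emeasure lborel B"
        using s C_nonneg \<epsilon> by (intro mult_right_mono ennreal_leI) auto
      finally show ?thesis
        using t L C_nonneg \<epsilon> by (simp add: ennreal_mult[symmetric])
    qed
  qed (use \<eta> \<theta> high h J L t C_nonneg \<epsilon> in auto)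
  also have "\<dots> = t * J + t * L * (3 * \<theta> * (C + \<epsilon>))"
    using h(3) by (auto simp: algebra_simps simp flip: h(3))
  also have "\<dots> \<le> t * J + t * L * \<epsilon>"
    using \<theta>(2) t L by (intro add_left_mono mult_left_mono) auto
  finally have "ennreal (prob {\<omega>\<in>space M. walk_max n (\<lambda>i. \<xi> i \<omega>) \<in> B}) \<le> ennreal (t * J + t * L * \<epsilon>)"
    by (rule ennreal_leI)
  also have "\<dots> = ennreal (t * J) + ennreal (t * \<epsilon>) * ennreal L"
    using t J L \<epsilon> by (simp add: ennreal_plus ennreal_mult[symmetric] mult_ac)
  also have "\<dots> = (\<integral>\<^sup>+y. ennreal (t * (\<nu> y + 2 * \<epsilon>)) * indicator B y + ennreal (t * \<epsilon>) * indicator B y \<partial>lborel)"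
    using Jm[OF t] L by (simp add: nn_integral_add nn_integral_cmult)
  also have "\<dots> = (\<integral>\<^sup>+y\<in>B. ennreal (t * (\<nu> y + 3 * \<epsilon>)) \<partial>lborel)"
    using t \<nu>_nonneg \<epsilon>
    by (intro nn_integral_cong) (auto simp: indicator_def algebra_simps simp flip: ennreal_plus)
  finally show ?thesis unfolding \<xi>_def h_def n_def .
qed

text \<open>Here the main term is multiplied by 1 - \<theta>. The loss is at most \<epsilon> because
  \<open>\<nu>\<close> is bounded by \<open>C\<close> on \<open>B\<close>, which accounts for the
  third \<open>\<epsilon>\<close>.\<close>

lemma prob_walk_max_grid_ge:
  assumes B[measurable]: "B \<in> sets borel" and fin: "emeasure lborel B \<noteq> \<infinity>" and high: "B \<subseteq> {4 * a..}"
  shows "(\<integral>\<^sup>+y\<in>B. ennreal (t * (\<nu> y - 3 * \<epsilon>)) \<partial>lborel) \<le> ennreal (prob {\<omega>\<in>space M.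
      walk_max (Suc m) (\<lambda>i. X (real (Suc i) * (t / real (Suc m))) \<omega> - X (real i * (t / real (Suc m))) \<omega>) \<in> B})"
proof -
  define n h where "n = Suc m" and "h = t / real n"
  have h: "0 < h" "h \<le> t" "real n * h = t"
    using t grid_time[of 1 m] by (auto simp: h_def n_def)
  define J where "J = enn2real (\<integral>\<^sup>+y\<in>B. ennreal (\<nu> y - 2 * \<epsilon>) \<partial>lborel)"
  have hiB: "B \<subseteq> {a..}" using high \<eta> by force
  have J: "(\<integral>\<^sup>+y\<in>B. ennreal (\<nu> y - 2 * \<epsilon>) \<partial>lborel) = ennreal J" "0 \<le> J"
    using set_nn_integral_bounded[OF B fin hiB, of "\<lambda>y. \<nu> y - 2 * \<epsilon>" "C - 2 * \<epsilon>"] \<nu>_le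
    by (auto simp: J_def less_top)
  have Jm: "(\<integral>\<^sup>+y\<in>B. ennreal (s * (\<nu> y - 2 * \<epsilon>)) \<partial>lborel) = ennreal (s * J)" if "0 \<le> s" for s
  proof -
    have "(\<integral>\<^sup>+y\<in>B. ennreal (s * (\<nu> y - 2 * \<epsilon>)) \<partial>lborel) =
        (\<integral>\<^sup>+y. ennreal s * (ennreal (\<nu> y - 2 * \<epsilon>) * indicator B y) \<partial>lborel)"
      \<comment> \<open>The factor \<open>\<nu> y - 2 * \<epsilon>\<close> may be negative;
        \<open>ennreal\<close> truncates it to 0, which commutes with scaling by a nonnegative
        \<open>s\<close>.\<close>
      using that by (intro nn_integral_cong) (simp add: ennreal_mult' mult.assoc)
    also have "\<dots> = ennreal (s * J)"
      using that J by (simp add: nn_integral_cmult ennreal_mult)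
    finally show ?thesis .
  qed
  define \<xi> where "\<xi> i \<omega> = X (real (Suc i) * h) \<omega> - X (real i * h) \<omega>" for i \<omega>
  have indep: "indep_vars (\<lambda>_. borel) \<xi> {..<n}"
    unfolding \<xi>_def using h by (intro indep_vars_grid) auto
  have sum: "(\<Sum>i<k. \<xi> i \<omega>) = X (real k * h) \<omega> - X 0 \<omega>" for k \<omega>
    unfolding \<xi>_def by (rule sum_grid_increments)
  have step: "ennreal (prob {\<omega>\<in>space M. \<xi> j \<omega> + g \<in> B}) = emeasure (distr M borel (X h)) {v. v + g \<in> B}" for j g
    using emeasure_distr_eq_prob[of "real j * h" h "{v. v + g \<in> B}"] h
    unfolding \<xi>_def grid_step by simp
  have le: "n * (h * J * (1 - \<theta>)) \<le> prob {\<omega>\<in>space M. walk_max n (\<lambda>i. \<xi> i \<omega>) \<in> B}"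
  proof (rule prob_walk_max_ge[OF indep \<eta>(1)])
    show "prob {\<omega>\<in>space M. \<exists>k\<le>n. \<eta> < \<bar>\<Sum>i<k. \<xi> i \<omega>\<bar>} \<le> \<theta>"
      using small[of m] unfolding sum h_def n_def .
    show "h * J \<le> prob {\<omega>\<in>space M. \<xi> j \<omega> + g \<in> B}" if "\<bar>g\<bar> \<le> 3 * \<eta>" for j g
      using law_shift_ge[OF h(1,2) B high that] h J unfolding step[symmetric, of g j] Jm[OF less_imp_le[OF h(1)]]
      by simp
    show "B \<subseteq> {10 * \<eta>..}" using high \<eta> by force
  qed (use h J in auto)
  have eq: "real n * (h * J * (1 - \<theta>)) = (t * (1 - \<theta>)) * J"
    using h(3) by (auto simp: mult_ac simp flip: h(3))
  have "(\<integral>\<^sup>+y\<in>B. ennreal (t * (\<nu> y - 3 * \<epsilon>)) \<partial>lborel) \<le> (\<integral>\<^sup>+y\<in>B. ennreal (t * (1 - \<theta>) * (\<nu> y - 2 * \<epsilon>)) \<partial>lborel)"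
  proof (intro nn_integral_mono)
    fix y
    show "ennreal (t * (\<nu> y - 3 * \<epsilon>)) * indicator B y \<le> ennreal (t * (1 - \<theta>) * (\<nu> y - 2 * \<epsilon>)) * indicator B y"
    proof (cases "y \<in> B")
      case True
      have "\<theta> * \<nu> y \<le> \<theta> * (C + \<epsilon>)"
        using True hiB \<nu>_le[of y] \<theta>_nonneg \<epsilon> by (intro mult_left_mono) auto
      also have "\<dots> \<le> 3 * \<theta> * (C + \<epsilon>)" using \<theta>_nonneg C_nonneg \<epsilon> by simp
      finally have "\<theta> * \<nu> y \<le> \<epsilon>" using \<theta>(2) by linarith
      moreover have "0 \<le> \<theta> * \<epsilon>" using \<theta>_nonneg \<epsilon> by simp
      ultimately have "\<nu> y - 3 * \<epsilon> \<le> (1 - \<theta>) * (\<nu> y - 2 * \<epsilon>)"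
        by (simp add: algebra_simps)
      then show ?thesis using t True by (auto simp: mult.assoc intro!: ennreal_leI mult_left_mono)
    qed simp
  qed
  also have "\<dots> = ennreal (t * (1 - \<theta>) * J)" using t \<theta> by (intro Jm) auto
  also have "\<dots> \<le> ennreal (prob {\<omega>\<in>space M. walk_max n (\<lambda>i. \<xi> i \<omega>) \<in> B})"
    using le unfolding eq by (rule ennreal_leI)
  finally show ?thesis unfolding \<xi>_def h_def n_def .
qed

lemma distr_running_sup_open_le:
  assumes U: "open U" "bounded U" "U \<subseteq> {4 * a..}"
  shows "emeasure (distr M borel (running_sup X t)) U \<le> (\<integral>\<^sup>+y\<in>U. ennreal (t * (\<nu> y + 3 * \<epsilon>)) \<partial>lborel)"
proof -
  have [measurable]: "U \<in> sets borel" using U by simp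
  have fin: "emeasure lborel U \<noteq> \<infinity>" using emeasure_bounded_finite[OF U(2)] by simp
  have "U \<subseteq> {a..}" using U(3) \<eta> by force
  then have "(\<integral>\<^sup>+y\<in>U. ennreal (t * (\<nu> y + 3 * \<epsilon>)) \<partial>lborel) \<noteq> \<infinity>"
    using \<nu>_le t by (intro set_nn_integral_bounded[where K="t * (C + 3 * \<epsilon>)"] fin) auto
  then obtain c where c: "0 \<le> c" "(\<integral>\<^sup>+y\<in>U. ennreal (t * (\<nu> y + 3 * \<epsilon>)) \<partial>lborel) = ennreal c"
    by (cases "\<integral>\<^sup>+y\<in>U. ennreal (t * (\<nu> y + 3 * \<epsilon>)) \<partial>lborel" rule: ennreal_cases) auto
  have "prob {\<omega>\<in>space M. running_sup (\<lambda>s \<omega>. X s \<omega> - X 0 \<omega>) t \<omega> \<in> U} \<le> c"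
  proof (rule prob_limit_open_le[OF measurable_walk_max_grid[OF t] walk_max_grid_tendsto[OF t] U(1)])
    fix m
    show "prob {\<omega>\<in>space M. walk_max (Suc m) (\<lambda>i. X (real (Suc i) * (t / real (Suc m))) \<omega> - X (real i * (t / real (Suc m))) \<omega>) \<in> U} \<le> c"
      using prob_walk_max_grid_le[of U m] U fin c by simp
  qed
  then show ?thesis unfolding c(2) by (subst emeasure_distr_running_sup[OF t]) (auto intro: ennreal_leI)
qed

lemma distr_running_sup_compact_ge:
  assumes T: "compact T" "T \<subseteq> {4 * a..}"
  shows "(\<integral>\<^sup>+y\<in>T. ennreal (t * (\<nu> y - 3 * \<epsilon>)) \<partial>lborel) \<le> emeasure (distr M borel (running_sup X t)) T"
proof -
  have [measurable]: "T \<in> sets borel" using T by (simp add: borel_compact)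
  have fin: "emeasure lborel T \<noteq> \<infinity>" using emeasure_compact_finite[OF T(1)] by simp
  have "T \<subseteq> {a..}" using T(2) \<eta> by force
  then have "(\<integral>\<^sup>+y\<in>T. ennreal (t * (\<nu> y - 3 * \<epsilon>)) \<partial>lborel) \<noteq> \<infinity>"
    using \<nu>_le t by (intro set_nn_integral_bounded[where K="t * (C - 3 * \<epsilon>)"] fin) auto
  then obtain c where c: "0 \<le> c" "(\<integral>\<^sup>+y\<in>T. ennreal (t * (\<nu> y - 3 * \<epsilon>)) \<partial>lborel) = ennreal c"
    by (cases "\<integral>\<^sup>+y\<in>T. ennreal (t * (\<nu> y - 3 * \<epsilon>)) \<partial>lborel" rule: ennreal_cases) auto
  have "c \<le> prob {\<omega>\<in>space M. running_sup (\<lambda>s \<omega>. X s \<omega> - X 0 \<omega>) t \<omega> \<in> T}"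
  proof (rule prob_limit_closed_ge[OF measurable_walk_max_grid[OF t] _ walk_max_grid_tendsto[OF t]])
    show "running_sup (\<lambda>s \<omega>. X s \<omega> - X 0 \<omega>) t \<in> borel_measurable M"
      by (rule borel_measurable_LIMSEQ_real[OF walk_max_grid_tendsto[OF t] measurable_walk_max_grid[OF t]])
    show "closed T" using T(1) by (rule compact_imp_closed)
    fix m
    show "c \<le> prob {\<omega>\<in>space M. walk_max (Suc m) (\<lambda>i. X (real (Suc i) * (t / real (Suc m))) \<omega> - X (real i * (t / real (Suc m))) \<omega>) \<in> T}"
      using prob_walk_max_grid_ge[of T m] T fin c by simp
  qed
  then show ?thesis unfolding c(2) by (subst emeasure_distr_running_sup[OF t]) (auto intro: ennreal_leI)
qed

end

end

text \<open>A large value \<nu>(y) stays large on an interval of fixed length to the right of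
  \<open>y\<close>, and the mass of that interval under a probability measure is at most 1. One unit
  is lost to the hypothesis \<open>ge\<close>, one to the variation of \<open>\<nu>\<close>; length
  \<open>d / 2\<close> keeps distances strictly below \<open>d\<close>.\<close>

lemma uniformly_continuous_dominated_bounded:
  fixes \<nu> :: "real \<Rightarrow> real"
  assumes \<mu>: "prob_space \<mu>" "sets \<mu> = sets borel"
    and uc: "uniformly_continuous_on {a..} \<nu>" and s: "0 < s"
    and ge: "\<And>B. B \<in> sets borel \<Longrightarrow> B \<subseteq> {a..} \<Longrightarrow> (\<integral>\<^sup>+x\<in>B. ennreal (s * (\<nu> x - 1)) \<partial>lborel) \<le> emeasure \<mu> B"
  shows "\<exists>C. \<forall>x\<ge>a. \<nu> x \<le> C"
proof -
  interpret prob_space \<mu> by fact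
  obtain d where d: "0 < d" "\<And>x y. a \<le> x \<Longrightarrow> a \<le> y \<Longrightarrow> \<bar>x - y\<bar> < d \<Longrightarrow> \<bar>\<nu> x - \<nu> y\<bar> < 1"
    using uc unfolding uniformly_continuous_on_def
    by (metis atLeast_iff dist_real_def zero_less_one)
  have "\<nu> y \<le> 2 + 2 / (s * d)" if y: "a \<le> y" for y
  proof (cases "2 \<le> \<nu> y")
    case True
    have "ennreal (s * (\<nu> y - 2) * (d / 2)) = ennreal (s * (\<nu> y - 2)) * emeasure lborel {y..y + d / 2}"
      using True s d by (subst ennreal_mult) auto
    also have "\<dots> = (\<integral>\<^sup>+x. ennreal (s * (\<nu> y - 2)) * indicator {y..y + d / 2} x \<partial>lborel)"
      by (simp add: nn_integral_cmult)
    also have "\<dots> \<le> (\<integral>\<^sup>+x\<in>{y..y + d / 2}. ennreal (s * (\<nu> x - 1)) \<partial>lborel)"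
    proof (intro nn_integral_mono)
      fix x
      show "ennreal (s * (\<nu> y - 2)) * indicator {y..y + d / 2} x
        \<le> ennreal (s * (\<nu> x - 1)) * indicator {y..y + d / 2} x"
      proof (cases "x \<in> {y..y + d / 2}")
        case True
        then have "\<bar>\<nu> y - \<nu> x\<bar> < 1" using d y by auto
        then show ?thesis using s True by (auto intro!: ennreal_leI mult_left_mono)
      qed simp
    qed
    also have "\<dots> \<le> emeasure \<mu> {y..y + d / 2}" using y by (intro ge) auto
    also have "\<dots> \<le> ennreal 1" by (simp add: emeasure_le_1)
    finally have "s * (\<nu> y - 2) * (d / 2) \<le> 1" by (subst (asm) ennreal_le_iff) auto
    then show ?thesis using s d by (simp add: field_simps)
  next
    case False
    then show ?thesis using s d by (simp add: add_increasing2)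
  qed
  then show ?thesis by blast
qed

text \<open>A density is constrained on \<open>S\<close> only; multiplying by the indicator gives a
  globally Borel function with the same integrals over subsets of \<open>S\<close>.\<close>

lemma has_density_on_set_nn_integral:
  assumes g: "has_density_on \<mu> S g" and S: "S \<in> sets borel"
  shows "(\<lambda>x. ennreal (indicator S x * g x)) \<in> borel_measurable borel"
    and "B \<in> sets borel \<Longrightarrow> B \<subseteq> S \<Longrightarrow> emeasure \<mu> B = (\<integral>\<^sup>+x\<in>B. ennreal (indicator S x * g x) \<partial>lborel)"
proof -
  show "(\<lambda>x. ennreal (indicator S x * g x)) \<in> borel_measurable borel"
    using g unfolding has_density_on_def set_borel_measurable_def
    by (intro measurable_compose[OF _ measurable_ennreal]) simp
  assume B: "B \<in> sets borel" "B \<subseteq> S"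
  have "emeasure \<mu> B = (\<integral>\<^sup>+x\<in>B. ennreal (g x) \<partial>lborel)"
    using g B unfolding has_density_on_def by blast
  also have "\<dots> = (\<integral>\<^sup>+x\<in>B. ennreal (indicator S x * g x) \<partial>lborel)"
    using B by (intro nn_integral_cong) (auto simp: indicator_def)
  finally show "emeasure \<mu> B = (\<integral>\<^sup>+x\<in>B. ennreal (indicator S x * g x) \<partial>lborel)" .
qed

lemma ess_uniform_limit_cong:
  assumes "AE x in lborel. x \<in> S \<longrightarrow> h x = h' x"
  shows "ess_uniform_limit S g h F \<longleftrightarrow> ess_uniform_limit S g h' F"
proof -
  have "(AE x in lborel. x \<in> S \<longrightarrow> dist (g t x) (h x) < \<epsilon>) \<longleftrightarrow>
      (AE x in lborel. x \<in> S \<longrightarrow> dist (g t x) (h' x) < \<epsilon>)" for t \<epsilon>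
    using assms by (intro AE_cong_simp eventually_subst) (auto elim: eventually_mono)
  then show ?thesis unfolding ess_uniform_limit_def by simp
qed

lemma ess_uniform_limit_subset:
  assumes "ess_uniform_limit S g h F" "T \<subseteq> S"
  shows "ess_uniform_limit T g h F"
  unfolding ess_uniform_limit_def
proof (intro allI impI)
  fix \<epsilon> :: real assume "0 < \<epsilon>"
  with assms(1) have "\<forall>\<^sub>F t in F. AE x in lborel. x \<in> S \<longrightarrow> dist (g t x) (h x) < \<epsilon>"
    by (simp add: ess_uniform_limit_def)
  then show "\<forall>\<^sub>F t in F. AE x in lborel. x \<in> T \<longrightarrow> dist (g t x) (h x) < \<epsilon>"
    by eventually_elim (use assms(2) in \<open>auto elim: eventually_mono\<close>)
qed

section \<open>Small-time behaviour of the density of the running supremum\<close>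

context levy_process
begin

lemma law_between:
  assumes s: "0 < s" and p: "has_density_on (distr M borel (X s)) {0..} q" and a: "0 \<le> a"
    and close: "AE x in lborel. x \<in> {a..} \<longrightarrow> dist (q x / s) (\<nu> x) < \<epsilon>"
    and B: "B \<in> sets borel" "B \<subseteq> {a..}"
  shows "emeasure (distr M borel (X s)) B \<le> (\<integral>\<^sup>+x\<in>B. ennreal (s * (\<nu> x + \<epsilon>)) \<partial>lborel)"
    and "(\<integral>\<^sup>+x\<in>B. ennreal (s * (\<nu> x - \<epsilon>)) \<partial>lborel) \<le> emeasure (distr M borel (X s)) B"
proof -
  have "B \<subseteq> {0..}" using B a by auto
  then have eq: "emeasure (distr M borel (X s)) B = (\<integral>\<^sup>+x\<in>B. ennreal (q x) \<partial>lborel)"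
    using p B unfolding has_density_on_def by blast
  have "AE x in lborel. x \<in> B \<longrightarrow> q x \<le> s * (\<nu> x + \<epsilon>) \<and> s * (\<nu> x - \<epsilon>) \<le> q x"
    using close
  proof eventually_elim
    case (elim x)
    show ?case
    proof
      assume "x \<in> B"
      then have "\<bar>q x / s - \<nu> x\<bar> < \<epsilon>" using elim B by (auto simp: dist_real_def)
      then have "q x / s \<le> \<nu> x + \<epsilon>" "\<nu> x - \<epsilon> \<le> q x / s" by linarith+
      then show "q x \<le> s * (\<nu> x + \<epsilon>) \<and> s * (\<nu> x - \<epsilon>) \<le> q x"
        using s by (simp add: field_simps)
    qed
  qed
  then have "AE x in lborel. ennreal (q x) * indicator B x \<le> ennreal (s * (\<nu> x + \<epsilon>)) * indicator B x"
    "AE x in lborel. ennreal (s * (\<nu> x - \<epsilon>)) * indicator B x \<le> ennreal (q x) * indicator B x"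
    by (auto elim!: eventually_mono simp: indicator_def intro!: ennreal_leI)
  then show "emeasure (distr M borel (X s)) B \<le> (\<integral>\<^sup>+x\<in>B. ennreal (s * (\<nu> x + \<epsilon>)) \<partial>lborel)"
    "(\<integral>\<^sup>+x\<in>B. ennreal (s * (\<nu> x - \<epsilon>)) \<partial>lborel) \<le> emeasure (distr M borel (X s)) B"
    unfolding eq by (auto intro: nn_integral_mono_AE)
qed

text \<open>Parameters are fixed in the order \<open>\<epsilon>\<close>, \<open>\<eta>\<close>,
  \<open>\<theta>\<close>, \<open>t\<close>: \<open>\<eta>\<close> from the modulus of continuity at
  \<open>\<epsilon>\<close>, \<open>\<theta>\<close> from \<open>\<epsilon>\<close> and
  \<open>C\<close>, and \<open>t\<close> small enough for both the law comparison and the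
  oscillation bound.\<close>

lemma running_sup_density_small_time:
  fixes \<nu> :: "real \<Rightarrow> real"
  assumes p: "\<And>t. 0 < t \<Longrightarrow> has_density_on (distr M borel (X t)) {0..} (p t)"
    and f: "\<And>t. 0 < t \<Longrightarrow> has_density_on (distr M borel (running_sup X t)) {0<..} (f t)"
    and \<nu>[measurable]: "\<nu> \<in> borel_measurable borel" and \<nu>_nonneg: "\<And>x. 0 \<le> \<nu> x"
    and a: "0 < a" and uc: "uniformly_continuous_on {a..} \<nu>"
    and lim: "ess_uniform_limit {a..} (\<lambda>t x. p t x / t) \<nu> (at_right 0)"
  shows "ess_uniform_limit {4 * a<..} (\<lambda>t x. f t x / t) \<nu> (at_right 0)"
proof -
  have law: "\<exists>b>0. \<forall>s B. 0 < s \<longrightarrow> s < b \<longrightarrow> B \<in> sets borel \<longrightarrow> B \<subseteq> {a..} \<longrightarrow>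
      emeasure (distr M borel (X s)) B \<le> (\<integral>\<^sup>+x\<in>B. ennreal (s * (\<nu> x + \<epsilon>)) \<partial>lborel) \<and>
      (\<integral>\<^sup>+x\<in>B. ennreal (s * (\<nu> x - \<epsilon>)) \<partial>lborel) \<le> emeasure (distr M borel (X s)) B"
    if "0 < \<epsilon>" for \<epsilon>
  proof -
    have "\<forall>\<^sub>F s in at_right 0. AE x in lborel. x \<in> {a..} \<longrightarrow> dist (p s x / s) (\<nu> x) < \<epsilon>"
      using lim \<open>0 < \<epsilon>\<close> by (simp add: ess_uniform_limit_def)
    then obtain b where b: "0 < b"
        "\<And>s. 0 < s \<Longrightarrow> s < b \<Longrightarrow> AE x in lborel. x \<in> {a..} \<longrightarrow> dist (p s x / s) (\<nu> x) < \<epsilon>"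
      unfolding eventually_at_right_field by blast
    then show ?thesis
      using law_between[OF _ p less_imp_le[OF a] b(2)] by (intro exI[of _ b]) blast
  qed
  \<comment> \<open>Boundedness comes from the law comparison with error 1, read at the single time
    \<open>b / 2\<close>.\<close>
  obtain C where C: "\<And>x. a \<le> x \<Longrightarrow> \<nu> x \<le> C"
  proof -
    obtain b where b: "0 < b" "\<And>s B. 0 < s \<Longrightarrow> s < b \<Longrightarrow> B \<in> sets borel \<Longrightarrow> B \<subseteq> {a..} \<Longrightarrow>
      (\<integral>\<^sup>+x\<in>B. ennreal (s * (\<nu> x - 1)) \<partial>lborel) \<le> emeasure (distr M borel (X s)) B"
      using law[OF zero_less_one] by blast
    have "\<exists>C. \<forall>x\<ge>a. \<nu> x \<le> C"
    proof (rule uniformly_continuous_dominated_bounded[OF _ _ uc])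
      show "prob_space (distr M borel (X (b / 2)))"
        using b(1) by (intro prob_space_distr measurable_X) auto
      show "0 < b / 2" using b(1) by simp
      show "(\<integral>\<^sup>+x\<in>B. ennreal (b / 2 * (\<nu> x - 1)) \<partial>lborel) \<le> emeasure (distr M borel (X (b / 2))) B"
        if "B \<in> sets borel" "B \<subseteq> {a..}" for B
        using b(1) that by (intro b(2)) auto
    qed simp
    then show ?thesis using that by blast
  qed
  have "0 \<le> C" using C[of a] \<nu>_nonneg[of a] by simp
  show ?thesis
    unfolding ess_uniform_limit_def
  proof (intro allI impI)
    fix \<epsilon>' :: real assume "0 < \<epsilon>'"
    \<comment> \<open>The final estimate is non-strict with error 3\<epsilon>; dividing by 4 leaves
      room for the strict inequality.\<close>
    define \<epsilon> where "\<epsilon> = \<epsilon>' / 4"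
    have \<epsilon>: "0 < \<epsilon>" "3 * \<epsilon> < \<epsilon>'" using \<open>0 < \<epsilon>'\<close> by (auto simp: \<epsilon>_def)
    obtain d where d: "0 < d" "\<And>x y. a \<le> x \<Longrightarrow> a \<le> y \<Longrightarrow> \<bar>x - y\<bar> < d \<Longrightarrow> \<bar>\<nu> x - \<nu> y\<bar> < \<epsilon>"
      using uc \<epsilon>(1) unfolding uniformly_continuous_on_def by (metis atLeast_iff dist_real_def)
    \<comment> \<open>\<open>a / 10\<close> serves the separation of heights in the lower bound,
      \<open>d / 4\<close> puts shifts of 3\<eta> strictly inside the modulus of continuity.\<close>
    define \<eta> where "\<eta> = min (a / 10) (d / 4)"
    have \<eta>: "0 < \<eta>" "10 * \<eta> \<le> a" "3 * \<eta> < d" using a d by (auto simp: \<eta>_def min_def)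
    define \<theta> where "\<theta> = min (1 / 2) (\<epsilon> / (3 * (C + \<epsilon>)))"
    have \<theta>: "0 < \<theta>" "\<theta> \<le> 1 / 2" using \<epsilon> \<open>0 \<le> C\<close> by (auto simp: \<theta>_def)
    have "\<theta> \<le> \<epsilon> / (3 * (C + \<epsilon>))" by (simp add: \<theta>_def)
    then have \<theta>_C: "3 * \<theta> * (C + \<epsilon>) \<le> \<epsilon>" using \<epsilon> \<open>0 \<le> C\<close> by (simp add: field_simps)
    obtain b where b: "0 < b" "\<And>s B. 0 < s \<Longrightarrow> s < b \<Longrightarrow> B \<in> sets borel \<Longrightarrow> B \<subseteq> {a..} \<Longrightarrow>
        emeasure (distr M borel (X s)) B \<le> (\<integral>\<^sup>+x\<in>B. ennreal (s * (\<nu> x + \<epsilon>)) \<partial>lborel) \<and>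
        (\<integral>\<^sup>+x\<in>B. ennreal (s * (\<nu> x - \<epsilon>)) \<partial>lborel) \<le> emeasure (distr M borel (X s)) B"
      using law[OF \<epsilon>(1)] by blast
    obtain b' where b': "0 < b'" "\<And>t m. 0 < t \<Longrightarrow> t < b' \<Longrightarrow>
        prob {\<omega>\<in>space M. \<exists>k\<le>Suc m. \<eta> < \<bar>X (real k * (t / real (Suc m))) \<omega> - X 0 \<omega>\<bar>} \<le> \<theta>"
      using small_time_oscillation[OF \<eta>(1) \<theta>(1)] by blast
    have "AE x in lborel. x \<in> {4 * a<..} \<longrightarrow> dist (f t x / t) (\<nu> x) < \<epsilon>'" if t: "0 < t" "t < min b b'" for t
    proof -
      \<comment> \<open>The half-line is open so that Borel subsets can be approximated from outside
        by open sets within it.\<close>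
      let ?S = "{4 * a<..}"
      let ?F = "\<lambda>x. ennreal (indicator {0<..} x * f t x)"
      have S0: "?S \<subseteq> {0<..}" using a by auto
      have osc: "\<bar>\<nu> x - \<nu> y\<bar> \<le> \<epsilon>" if "a \<le> x" "a \<le> y" "\<bar>x - y\<bar> \<le> 3 * \<eta>" for x y
        using d(2)[of x y] that \<eta>(3) by force
      have le: "emeasure (distr M borel (X s)) B \<le> (\<integral>\<^sup>+x\<in>B. ennreal (s * (\<nu> x + \<epsilon>)) \<partial>lborel)"
        and ge: "(\<integral>\<^sup>+x\<in>B. ennreal (s * (\<nu> x - \<epsilon>)) \<partial>lborel) \<le> emeasure (distr M borel (X s)) B"
        if "0 < s" "s \<le> t" "B \<in> sets borel" "B \<subseteq> {a..}" for s B
        using b(2)[of s B] that t by auto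
      have small: "prob {\<omega>\<in>space M. \<exists>k\<le>Suc m. \<eta> < \<bar>X (real k * (t / real (Suc m))) \<omega> - X 0 \<omega>\<bar>} \<le> \<theta>" for m
        using b'(2)[of t m] t by auto
      have F[measurable]: "?F \<in> borel_measurable borel"
        using has_density_on_set_nn_integral(1)[OF f[OF t(1)]] by simp
      have F_eq: "emeasure (distr M borel (running_sup X t)) B = (\<integral>\<^sup>+x\<in>B. ?F x \<partial>lborel)"
        if "B \<in> sets borel" "B \<subseteq> ?S" for B
        using has_density_on_set_nn_integral(2)[OF f[OF t(1)] _ that(1) order_trans[OF that(2) S0]] by simp
      have bound: "ennreal (t * (\<nu> x + 3 * \<epsilon>)) \<le> ennreal (t * (C + 3 * \<epsilon>))"
        "ennreal (t * (\<nu> x - 3 * \<epsilon>)) \<le> ennreal (t * (C + 3 * \<epsilon>))" if "x \<in> ?S" for x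
        using C[of x] that a \<epsilon> t by (auto intro!: ennreal_leI mult_left_mono)
      have upper: "AE x in lborel. x \<in> ?S \<longrightarrow> ?F x \<le> ennreal (t * (\<nu> x + 3 * \<epsilon>))"
      proof (rule AE_le_from_set_nn_integral)
        show "min (?F x) (ennreal (t * (\<nu> x + 3 * \<epsilon>))) \<le> ennreal (t * (C + 3 * \<epsilon>))" if "x \<in> ?S" for x
          using bound(1)[OF that] by (rule min.coboundedI2)
        show "(\<integral>\<^sup>+x\<in>B. ?F x \<partial>lborel) \<le> (\<integral>\<^sup>+x\<in>B. ennreal (t * (\<nu> x + 3 * \<epsilon>)) \<partial>lborel)"
          if "B \<in> sets borel" "bounded B" "B \<subseteq> ?S" for B
        proof (rule set_nn_integral_le_from_open[OF _ _ _ bound(1) _ that])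
          fix U :: "real set" assume U: "open U" "bounded U" "U \<subseteq> ?S"
          show "(\<integral>\<^sup>+x\<in>U. ?F x \<partial>lborel) \<le> (\<integral>\<^sup>+x\<in>U. ennreal (t * (\<nu> x + 3 * \<epsilon>)) \<partial>lborel)"
            unfolding F_eq[OF borel_open[OF U(1)] U(3), symmetric]
            by (rule distr_running_sup_open_le[OF \<nu> \<nu>_nonneg C osc t(1) \<eta>(1,2) \<epsilon>(1) le ge small \<theta>(2) \<theta>_C U(1,2)])
               (use U(3) in auto)
        qed auto
      qed auto
      have lower: "AE x in lborel. x \<in> ?S \<longrightarrow> ennreal (t * (\<nu> x - 3 * \<epsilon>)) \<le> ?F x"
      proof (rule AE_le_from_set_nn_integral)
        show "min (ennreal (t * (\<nu> x - 3 * \<epsilon>))) (?F x) \<le> ennreal (t * (C + 3 * \<epsilon>))" if "x \<in> ?S" for x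
          using bound(2)[OF that] by (rule min.coboundedI1)
        show "(\<integral>\<^sup>+x\<in>B. ennreal (t * (\<nu> x - 3 * \<epsilon>)) \<partial>lborel) \<le> (\<integral>\<^sup>+x\<in>B. ?F x \<partial>lborel)"
          if "B \<in> sets borel" "bounded B" "B \<subseteq> ?S" for B
        proof (rule set_nn_integral_le_from_compact[OF _ _ bound(2) _ that])
          fix T :: "real set" assume T: "compact T" "T \<subseteq> ?S"
          show "(\<integral>\<^sup>+x\<in>T. ennreal (t * (\<nu> x - 3 * \<epsilon>)) \<partial>lborel) \<le> (\<integral>\<^sup>+x\<in>T. ?F x \<partial>lborel)"
            unfolding F_eq[OF borel_compact[OF T(1)] T(2), symmetric]
            by (rule distr_running_sup_compact_ge[OF \<nu> \<nu>_nonneg C osc t(1) \<eta>(1,2) \<epsilon>(1) le ge small \<theta>(2) \<theta>_C T(1)])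
               (use T(2) in auto)
        qed auto
      qed auto
      have "AE x in lborel. x \<in> {0<..} \<longrightarrow> 0 \<le> f t x"
        using f[OF t(1)] by (simp add: has_density_on_def)
      with upper lower show ?thesis
      proof eventually_elim
        case (elim x)
        show ?case
        proof
          assume x: "x \<in> ?S"
          then have x0: "x \<in> {0<..}" using S0 by (rule subsetD[rotated])
          have "f t x \<le> t * (\<nu> x + 3 * \<epsilon>)"
            using elim(1) x x0 t(1) \<nu>_nonneg[of x] \<epsilon>(1) by (simp add: ennreal_le_iff)
          \<comment> \<open>The left side may be negative; leaving \<open>ennreal\<close> is
            justified by nonnegativity of the right side.\<close>
          moreover have "t * (\<nu> x - 3 * \<epsilon>) \<le> f t x"
            using elim(2,3) x x0 by (simp add: ennreal_le_iff)
          ultimately have "\<bar>f t x / t - \<nu> x\<bar> \<le> 3 * \<epsilon>"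
            using t(1) by (simp add: abs_le_iff field_simps)
          then show "dist (f t x / t) (\<nu> x) < \<epsilon>'" using \<epsilon>(2) by (simp add: dist_real_def)
        qed
      qed
    qed
    then show "\<forall>\<^sub>F t in at_right 0. AE x in lborel. x \<in> {4 * a<..} \<longrightarrow> dist (f t x / t) (\<nu> x) < \<epsilon>'"
      unfolding eventually_at_right_field using b(1) b'(1) by (intro exI[of _ "min b b'"]) auto
  qed
qed

end

theorem theorem3p2:
  fixes M :: "'a measure"
    and X :: "real \<Rightarrow> 'a \<Rightarrow> real"
    and \<Lambda> :: "real measure"
    and p f :: "real \<Rightarrow> real \<Rightarrow> real"
    and \<nu> :: "real \<Rightarrow> real"
  assumes "levy_process M X"
    and "\<not> compound_poisson_process M X"
    and "\<not> subordinator M (\<lambda>t \<omega>. \<bar>X t \<omega>\<bar>)"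
    and "\<And>t. 0 < t \<Longrightarrow> has_density_on (distr M borel (X t)) {0..} (p t)"
    and "is_levy_measure M X \<Lambda>"
    and "has_density_on \<Lambda> {0<..} \<nu>"
    and "\<And>t. 0 < t \<Longrightarrow> has_density_on (distr M borel (running_sup X t)) {0<..} (f t)"
    and "\<exists>x1>0. uniformly_continuous_on {x1<..} \<nu>"
    and "\<exists>x0>0. ess_uniform_limit {x0..} (\<lambda>t x. p t x / t) \<nu> (at_right 0)"
  shows "\<exists>x2>0. ess_uniform_limit {x2..} (\<lambda>t x. f t x / t) \<nu> (at_right 0)"
proof -
  interpret levy_process M X by fact
  obtain x1 where x1: "0 < x1" "uniformly_continuous_on {x1<..} \<nu>" using assms(8) by blast
  obtain x0 where x0: "0 < x0" "ess_uniform_limit {x0..} (\<lambda>t x. p t x / t) \<nu> (at_right 0)"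
    using assms(9) by blast
  \<comment> \<open>The summand 1 places the closed half-line from \<open>a\<close> inside the open
    one from \<open>x1\<close>.\<close>
  define a where "a = max x0 (x1 + 1)"
  have a: "0 < a" "x0 \<le> a" "x1 < a" using x0 x1 by (auto simp: a_def)
  \<comment> \<open>A representative of \<open>\<nu>\<close> that is Borel and nonnegative
    everywhere; the density itself has these properties only on (0, \<infinity>), the second only
    almost everywhere.\<close>
  define \<nu>' where "\<nu>' x = max 0 (indicator {0<..} x * \<nu> x)" for x
  have "(\<lambda>x. indicator {0<..} x * \<nu> x) \<in> borel_measurable borel"
    using assms(6) unfolding has_density_on_def set_borel_measurable_def by simp
  then have meas: "\<nu>' \<in> borel_measurable borel" unfolding \<nu>'_def by measurable
  have "AE x in lborel. x \<in> {0<..} \<longrightarrow> 0 \<le> \<nu> x"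
    using assms(6) by (simp add: has_density_on_def)
  then have eq: "AE x in lborel. x \<in> {0<..} \<longrightarrow> \<nu> x = \<nu>' x"
    by eventually_elim (auto simp: \<nu>'_def)
  have eq_on: "AE x in lborel. x \<in> S \<longrightarrow> \<nu> x = \<nu>' x" if "S \<subseteq> {0<..}" for S
    using eq by eventually_elim (use that in auto)
  have uc: "uniformly_continuous_on {a..} \<nu>'"
    unfolding uniformly_continuous_on_def
  proof (intro allI impI)
    fix e :: real assume "0 < e"
    with x1(2) obtain d where d: "0 < d"
        "\<And>x y. x \<in> {x1<..} \<Longrightarrow> y \<in> {x1<..} \<Longrightarrow> dist y x < d \<Longrightarrow> dist (\<nu> y) (\<nu> x) < e"
      by (rule uniformly_continuous_onE) (rule that)
    have "dist (\<nu>' y) (\<nu>' x) < e" if "x \<in> {a..}" "y \<in> {a..}" "dist y x < d" for x y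
    proof -
      \<comment> \<open>Truncation at 0 is a contraction, so the modulus of continuity is
        inherited.\<close>
      have "dist (\<nu>' y) (\<nu>' x) \<le> dist (\<nu> y) (\<nu> x)"
        using that a(1) by (auto simp: \<nu>'_def dist_real_def max_def)
      also have "\<dots> < e" using that a(3) by (intro d(2)) auto
      finally show ?thesis .
    qed
    with d(1) show "\<exists>d>0. \<forall>x\<in>{a..}. \<forall>x'\<in>{a..}. dist x' x < d \<longrightarrow> dist (\<nu>' x') (\<nu>' x) < e"
      by blast
  qed
  have "ess_uniform_limit {a..} (\<lambda>t x. p t x / t) \<nu> (at_right 0)"
    using a(2) by (intro ess_uniform_limit_subset[OF x0(2)]) auto
  then have "ess_uniform_limit {a..} (\<lambda>t x. p t x / t) \<nu>' (at_right 0)"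
    by (subst (asm) ess_uniform_limit_cong[OF eq_on]) (use a in auto)
  then have "ess_uniform_limit {4 * a<..} (\<lambda>t x. f t x / t) \<nu>' (at_right 0)"
    using assms(4,7) meas a(1) uc by (intro running_sup_density_small_time) (auto simp: \<nu>'_def)
  then have "ess_uniform_limit {4 * a<..} (\<lambda>t x. f t x / t) \<nu> (at_right 0)"
    by (subst ess_uniform_limit_cong[OF eq_on]) (use a in auto)
  \<comment> \<open>Any point beyond \<open>4 * a\<close> turns the open half-line into a closed
    one.\<close>
  then have "ess_uniform_limit {5 * a..} (\<lambda>t x. f t x / t) \<nu> (at_right 0)"
    by (rule ess_uniform_limit_subset) (use a in auto)
  with a(1) show ?thesis by (intro exI[of _ "5 * a"]) simp
qed

end
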